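(* Let $0<\gamma<\frac{1}{12\sqrt2}$, $\delta>0$, and let $\delta_n=2^{-\delta n}$, $n\ge1$. Let $0<\epsilon<M$ and $x\in[\epsilon,M]$. Then for every $\ell\in(1,2)$ the sequence $\{Q_n(x)\}_{n\ge1}$ is Cauchy in $L^{\ell}$, and $$Q_n(x)\to Q(x)\quad\text{in }L^{\ell}.$$
   Context: On the upper half-plane $\mathbb{H}$ with hyperbolic measure $d\lambda=y^{-2}dx\,dy$, let $W$ be the centered Gaussian process indexed by Borel sets of finite $\lambda$-measure and bounded horizontal extent, with $\mathbb{E}[W(A)W(B)]=\lambda(A\cap B)$. For $0<\varepsilon<1$ and $x_0\in\mathbb{R}$ let $\mathcal{S}^{1}_{\varepsilon}(x_0):=\{(x,y)\in\mathbb{H}: |x-x_0|\le1/2,\ \max(2|x-x_0|,\varepsilon)<y\le1\}$ and $U^{1}_{\varepsilon}(x_0):=W(\mathcal{S}^{1}_{\varepsilon}(x_0))$. Set $\eta_{\varepsilon}(A):=\int_A e^{\gamma U^{1}_{\varepsilon}(s)-\frac{\gamma^2}{2}\mathbb{E}[U^{1}_{\varepsilon}(s)^2]}ds$ and let $\eta:=\lim_{\varepsilon\to0}\eta_\varepsilon$ be the Gaussian multiplicative chaos measure on $[0,\infty)$. Put $\eta_n:=\eta_{\delta_n}$ (lower-truncated field $U^1_{\delta_n}$), $Q_n(x):=\inf\{t\ge0:\eta_n[0,t]\ge x\}$ and $Q(x):=\inf\{t\ge0:\eta[0,t]\ge x\}$. *)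

theory Defs
  imports "HOL-Probability.Probability"
begin

definition upper_half_plane :: "(real \<times> real) set" where
  "upper_half_plane = {p. 0 < snd p}"

definition hyperbolic_measure :: "(real \<times> real) measure" where
  "hyperbolic_measure =
     density (restrict_space lborel upper_half_plane) (\<lambda>p. ennreal (1 / (snd p)\<^sup>2))"

definition noise_sets :: "(real \<times> real) set set" where
  "noise_sets = {A \<in> sets hyperbolic_measure.
     emeasure hyperbolic_measure A < \<infinity> \<and> bounded (fst ` A)}"

(* The degenerate Gaussian (variance 0) has no density and is listed separately. *)
definition centered_gaussian :: "'a measure \<Rightarrow> ('a \<Rightarrow> real) \<Rightarrow> bool" where
  "centered_gaussian M X \<longleftrightarrow>
     X \<in> borel_measurable M \<and>
     ((AE \<omega> in M. X \<omega> = 0) \<or>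
      (\<exists>\<sigma>>0. distributed M lborel X (\<lambda>z. ennreal (normal_density 0 \<sigma> z))))"

definition centered_gaussian_process ::
    "'a measure \<Rightarrow> 'i set \<Rightarrow> ('i \<Rightarrow> 'a \<Rightarrow> real) \<Rightarrow> bool" where
  "centered_gaussian_process M I X \<longleftrightarrow>
     (\<forall>F c. finite F \<and> F \<subseteq> I \<longrightarrow>
        centered_gaussian M (\<lambda>\<omega>. \<Sum>i\<in>F. c i * X i \<omega>))"

definition hyperbolic_white_noise ::
    "'a measure \<Rightarrow> ((real \<times> real) set \<Rightarrow> 'a \<Rightarrow> real) \<Rightarrow> bool" where
  "hyperbolic_white_noise M W \<longleftrightarrow>
     prob_space M \<and>
     centered_gaussian_process M noise_sets W \<and>
     (\<forall>A\<in>noise_sets. \<forall>B\<in>noise_sets.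
        (\<integral>\<omega>. W A \<omega> * W B \<omega> \<partial>M) = measure hyperbolic_measure (A \<inter> B))"

definition truncated_cone :: "real \<Rightarrow> real \<Rightarrow> (real \<times> real) set" where
  "truncated_cone \<epsilon> x0 =
     {(x, y) \<in> upper_half_plane.
        \<bar>x - x0\<bar> \<le> 1 / 2 \<and> max (2 * \<bar>x - x0\<bar>) \<epsilon> < y \<and> y \<le> 1}"

(* U \<epsilon> s = W (truncated_cone \<epsilon> s) holds almost surely for each fixed pair (\<epsilon>, s), and the
   version U is chosen jointly continuous in (\<epsilon>, s). Such a version exists by Kolmogorov's
   continuity theorem; without path regularity the integral over s defining the chaos measure,
   and its limit along the continuous parameter \<epsilon>, would not be determined by the law of W. *)
definition cone_field ::
    "'a measure \<Rightarrow> ((real \<times> real) set \<Rightarrow> 'a \<Rightarrow> real) \<Rightarrow>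
     (real \<Rightarrow> real \<Rightarrow> 'a \<Rightarrow> real) \<Rightarrow> bool" where
  "cone_field M W U \<longleftrightarrow>
     (\<forall>\<epsilon>\<in>{0<..<1}. \<forall>s. U \<epsilon> s \<in> borel_measurable M \<and>
        (AE \<omega> in M. U \<epsilon> s \<omega> = W (truncated_cone \<epsilon> s) \<omega>)) \<and>
     (\<forall>\<omega>\<in>space M. continuous_on ({0<..<1} \<times> UNIV) (\<lambda>(\<epsilon>, s). U \<epsilon> s \<omega>))"

definition chaos_approx ::
    "'a measure \<Rightarrow> real \<Rightarrow> (real \<Rightarrow> real \<Rightarrow> 'a \<Rightarrow> real) \<Rightarrow>
     real \<Rightarrow> 'a \<Rightarrow> real measure" where
  "chaos_approx M \<gamma> U \<epsilon> \<omega> =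
     density (restrict_space lborel {0..})
       (\<lambda>s. ennreal (exp (\<gamma> * U \<epsilon> s \<omega> - \<gamma>\<^sup>2 / 2 * (\<integral>\<omega>'. (U \<epsilon> s \<omega>')\<^sup>2 \<partial>M))))"

definition random_measure_nonneg :: "'a measure \<Rightarrow> ('a \<Rightarrow> real measure) \<Rightarrow> bool" where
  "random_measure_nonneg M \<eta> \<longleftrightarrow>
     (\<forall>\<omega>\<in>space M. sets (\<eta> \<omega>) = sets (restrict_space borel {0..}) \<and>
        (\<forall>t\<ge>0. emeasure (\<eta> \<omega>) {0..t} < \<infinity>)) \<and>
     (\<forall>A\<in>sets (restrict_space borel {0..}). (\<lambda>\<omega>. emeasure (\<eta> \<omega>) A) \<in> borel_measurable M)"

(* Almost sure vague convergence on [0, \<infinity>). Test functions need not vanish at 0, so no mass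
   can be lost at the left endpoint. *)
definition chaos_limit ::
    "'a measure \<Rightarrow> real \<Rightarrow> (real \<Rightarrow> real \<Rightarrow> 'a \<Rightarrow> real) \<Rightarrow>
     ('a \<Rightarrow> real measure) \<Rightarrow> bool" where
  "chaos_limit M \<gamma> U \<eta> \<longleftrightarrow>
     random_measure_nonneg M \<eta> \<and>
     (AE \<omega> in M. \<forall>f :: real \<Rightarrow> real.
        continuous_on {0..} f \<and> (\<exists>R. \<forall>t>R. f t = 0) \<longrightarrow>
        ((\<lambda>\<epsilon>. \<integral>t. f t \<partial>(chaos_approx M \<gamma> U \<epsilon> \<omega>)) \<longlongrightarrow> (\<integral>t. f t \<partial>(\<eta> \<omega>))) (at_right 0))"

(* Extended-real valued, so that the infimum of the empty set is \<infinity>. *)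
definition mass_inverse :: "real measure \<Rightarrow> real \<Rightarrow> ereal" where
  "mass_inverse \<mu> x = (INF t \<in> {t. 0 \<le> t \<and> ennreal x \<le> emeasure \<mu> {0..t}}. ereal t)"

definition in_Lp :: "'a measure \<Rightarrow> real \<Rightarrow> ('a \<Rightarrow> ereal) \<Rightarrow> bool" where
  "in_Lp M p X \<longleftrightarrow>
     X \<in> borel_measurable M \<and> (AE \<omega> in M. \<bar>X \<omega>\<bar> \<noteq> \<infinity>) \<and>
     integrable M (\<lambda>\<omega>. \<bar>real_of_ereal (X \<omega>)\<bar> powr p)"

(* Only meaningful when both arguments satisfy in_Lp, since a Bochner integral that does not
   exist is 0 and real_of_ereal maps infinite values to 0. *)
definition Lp_dist :: "'a measure \<Rightarrow> real \<Rightarrow> ('a \<Rightarrow> ereal) \<Rightarrow> ('a \<Rightarrow> ereal) \<Rightarrow> real" where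
  "Lp_dist M p X Y =
     (\<integral>\<omega>. \<bar>real_of_ereal (X \<omega>) - real_of_ereal (Y \<omega>)\<bar> powr p \<partial>M) powr (1 / p)"

definition Lp_Cauchy :: "'a measure \<Rightarrow> real \<Rightarrow> (nat \<Rightarrow> 'a \<Rightarrow> ereal) \<Rightarrow> bool" where
  "Lp_Cauchy M p X \<longleftrightarrow>
     (\<forall>n. in_Lp M p (X n)) \<and>
     (\<forall>e>0. \<exists>N. \<forall>m\<ge>N. \<forall>n\<ge>N. Lp_dist M p (X m) (X n) < e)"

definition Lp_tendsto ::
    "'a measure \<Rightarrow> real \<Rightarrow> (nat \<Rightarrow> 'a \<Rightarrow> ereal) \<Rightarrow> ('a \<Rightarrow> ereal) \<Rightarrow> bool" where
  "Lp_tendsto M p X Y \<longleftrightarrow>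
     (\<forall>n. in_Lp M p (X n)) \<and> in_Lp M p Y \<and> (\<lambda>n. Lp_dist M p (X n) Y) \<longlonglongrightarrow> 0"

(* The sequence starts at n = 1: for n = 0 the truncation level would be 1, where the field is
   not constrained. *)
definition inverse_approx ::
    "'a measure \<Rightarrow> real \<Rightarrow> (real \<Rightarrow> real \<Rightarrow> 'a \<Rightarrow> real) \<Rightarrow>
     real \<Rightarrow> real \<Rightarrow> nat \<Rightarrow> 'a \<Rightarrow> ereal" where
  "inverse_approx M \<gamma> U \<delta> x n \<omega> =
     mass_inverse (chaos_approx M \<gamma> U (2 powr (- \<delta> * real n)) \<omega>) x"

end

theory Submission
  imports Defs
begin

text \<open>Cut \<open>[0, \<infinity>)\<close> into blocks whose lengths and gaps equal the correlation range of the field.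
  Distinct blocks are uncorrelated, so in the fourth moment of the sum of the centred block masses
  only the terms without an isolated block survive, and this moment is of order \<open>K\<^sup>2\<close> for \<open>K\<close> blocks.
  As \<open>\<gamma>\<close> is small, the constant depends neither on the truncation nor on the range. Chebyshev's
  inequality bounds the probability that \<open>K\<close> blocks carry less than half of their mean mass by
  \<open>C / K\<^sup>2\<close>, which has two consequences. At range \<open>1\<close>, the probability that \<open>Q\<^sub>n(x)\<close>
  exceeds \<open>2K\<close> is at most \<open>C / K\<^sup>2\<close>, so the moments of \<open>Q\<^sub>n(x)\<close> of every order below \<open>2\<close> are bounded
  in \<open>n\<close>. As the range tends to \<open>0\<close>, and after discarding the coarse field (which costs only a
  positive factor), \<open>\<eta>\<close> almost surely charges every interval. Then \<open>Q\<close> is continuous, vague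
  convergence gives \<open>Q\<^sub>n(x) \<rightarrow> Q(x)\<close> almost surely, and the moment bounds upgrade this to
  convergence in \<open>L\<^sup>\<ell>\<close>. Only exponential moments of Gaussian variables enter; no independence
  is used.\<close>

section \<open>Exponential moments of the white noise\<close>

text \<open>Why the fourth moment: a variance bound gives tails of order \<open>1 / K\<close>,
  enough only for moments of order below 1, whereas \<open>1 / K\<^sup>2\<close> reaches every order
  below 2, which is the range of \<open>l\<close>.

  Why the constants are uniform: the fields at two points at distance d have covariance at most ln
  (r / d), whatever the truncation. In the fourth moment each pair of points can be made to carry
  the weight exp of \<open>6 * \<gamma>\<^sup>2\<close> times this covariance, and
  \<open>12 * \<gamma>\<^sup>2 \<le> 1\<close> makes it at most sqrt (r / d). This singularity is
  integrable on a line, and its average over a block of length r does not depend on r. On a finite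
  grid the truncation enters through the diagonal alone and disappears as the mesh is refined; hence
  moments are estimated for Riemann sums and carried over by Fatou's lemma.

  Why a second range: at range 1 a fixed interval contains a bounded number of blocks, and
  Chebyshev's inequality cannot exclude that they are all light. At range r the number of blocks is
  of order 1 / r, so the error tends to 0 with r.\<close>

lemma normal_density_exp:
  assumes "0 < \<sigma>"
  shows "normal_density 0 \<sigma> z * exp z = exp (\<sigma>\<^sup>2 / 2) * normal_density (\<sigma>\<^sup>2) \<sigma> z"
proof -
  \<comment> \<open>Completing the square: tilting by \<open>exp\<close> moves the mean from 0 to
    \<open>\<sigma>\<^sup>2\<close> and leaves a multiple of another normal density, whose integral
    is 1.\<close>
  have "- z\<^sup>2 / (2 * \<sigma>\<^sup>2) + z = \<sigma>\<^sup>2 / 2 - (z - \<sigma>\<^sup>2)\<^sup>2 / (2 * \<sigma>\<^sup>2)"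
    using assms by (simp add: field_simps power2_eq_square)
  then have "exp (- z\<^sup>2 / (2 * \<sigma>\<^sup>2)) * exp z = exp (\<sigma>\<^sup>2 / 2) * exp (- (z - \<sigma>\<^sup>2)\<^sup>2 / (2 * \<sigma>\<^sup>2))"
    by (simp flip: exp_add)
  then show ?thesis
    by (simp add: normal_density_def)
qed

text \<open>The degenerate Gaussian has no density and is treated apart. The last claim holds
  because otherwise the second moment is \<open>\<sigma>\<^sup>2\<close>, which is positive; it
  turns covariance identities into almost sure ones.\<close>

lemma centered_gaussian_exp_moment:
  assumes "prob_space M" and "centered_gaussian M X"
  shows "integrable M (\<lambda>\<omega>. (X \<omega>)\<^sup>2)"
    and "integrable M (\<lambda>\<omega>. exp (X \<omega>))"
    and "(\<integral>\<omega>. exp (X \<omega>) \<partial>M) = exp ((\<integral>\<omega>. (X \<omega>)\<^sup>2 \<partial>M) / 2)"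
    and "(\<integral>\<omega>. (X \<omega>)\<^sup>2 \<partial>M) = 0 \<Longrightarrow> AE \<omega> in M. X \<omega> = 0"
proof -
  interpret prob_space M by fact
  have X [measurable]: "X \<in> borel_measurable M"
    using assms(2) by (simp add: centered_gaussian_def)
  have "integrable M (\<lambda>\<omega>. (X \<omega>)\<^sup>2) \<and> integrable M (\<lambda>\<omega>. exp (X \<omega>)) \<and>
    (\<integral>\<omega>. exp (X \<omega>) \<partial>M) = exp ((\<integral>\<omega>. (X \<omega>)\<^sup>2 \<partial>M) / 2) \<and>
    ((\<integral>\<omega>. (X \<omega>)\<^sup>2 \<partial>M) = 0 \<longrightarrow> (AE \<omega> in M. X \<omega> = 0))"
  proof (cases "AE \<omega> in M. X \<omega> = 0")
    case True
    have sq: "AE \<omega> in M. (X \<omega>)\<^sup>2 = 0" and ex: "AE \<omega> in M. exp (X \<omega>) = 1"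
      using True by auto
    have "integrable M (\<lambda>\<omega>. (X \<omega>)\<^sup>2)" "integrable M (\<lambda>\<omega>. exp (X \<omega>))"
      using integrable_cong_AE[OF _ _ sq] integrable_cong_AE[OF _ _ ex] by simp_all
    moreover have "(\<integral>\<omega>. (X \<omega>)\<^sup>2 \<partial>M) = 0" "(\<integral>\<omega>. exp (X \<omega>) \<partial>M) = 1"
      using integral_cong_AE[OF _ _ sq] integral_cong_AE[OF _ _ ex] by (simp_all add: prob_space)
    ultimately show ?thesis
      using True by simp
  next
    case False
    then obtain \<sigma> where \<sigma>: "0 < \<sigma>" and D: "distributed M lborel X (\<lambda>z. ennreal (normal_density 0 \<sigma> z))"
      using assms(2) by (auto simp: centered_gaussian_def)
    have "(\<integral>z. normal_density 0 \<sigma> z * z\<^sup>2 \<partial>lborel) = \<sigma>\<^sup>2"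
      using integral_normal_moment_even[OF \<sigma>, of 0 1] \<sigma> by simp
    then have var: "(\<integral>\<omega>. (X \<omega>)\<^sup>2 \<partial>M) = \<sigma>\<^sup>2"
      using distributed_integral[OF D, of "\<lambda>z. z\<^sup>2"] by simp
    have "integrable lborel (\<lambda>z. normal_density 0 \<sigma> z * z\<^sup>2)"
      using integrable_normal_moment[OF \<sigma>, of 0 2] by simp
    then have "integrable M (\<lambda>\<omega>. (X \<omega>)\<^sup>2)"
      using distributed_integrable[OF D, of "\<lambda>z. z\<^sup>2"] by simp
    moreover have "integrable M (\<lambda>\<omega>. exp (X \<omega>))"
      using distributed_integrable[OF D, of exp] \<sigma> by (simp add: normal_density_exp)
    moreover have "(\<integral>\<omega>. exp (X \<omega>) \<partial>M) = exp (\<sigma>\<^sup>2 / 2)"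
      using distributed_integral[OF D, of exp] \<sigma> by (simp add: normal_density_exp)
    ultimately show ?thesis
      using var \<sigma> by simp
  qed
  then show "integrable M (\<lambda>\<omega>. (X \<omega>)\<^sup>2)"
    and "integrable M (\<lambda>\<omega>. exp (X \<omega>))"
    and "(\<integral>\<omega>. exp (X \<omega>) \<partial>M) = exp ((\<integral>\<omega>. (X \<omega>)\<^sup>2 \<partial>M) / 2)"
    and "(\<integral>\<omega>. (X \<omega>)\<^sup>2 \<partial>M) = 0 \<Longrightarrow> AE \<omega> in M. X \<omega> = 0"
    by auto
qed

text \<open>The definition sums over sets of indices, whereas the members of a family may coincide;
  their coefficients are added up over the fibres of \<open>p\<close>.\<close>

lemma centered_gaussian_process_family:
  assumes "centered_gaussian_process M I X" and "finite J" and "p ` J \<subseteq> I"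
  shows "centered_gaussian M (\<lambda>\<omega>. \<Sum>j\<in>J. a j * X (p j) \<omega>)"
proof -
  have "(\<Sum>j\<in>J. a j * X (p j) \<omega>) = (\<Sum>i\<in>p ` J. (\<Sum>j\<in>{j\<in>J. p j = i}. a j) * X i \<omega>)" for \<omega>
    by (subst sum.image_gen[OF assms(2), where g = p])
      (auto simp: sum_distrib_right intro!: sum.cong)
  then show ?thesis
    using assms by (simp add: centered_gaussian_process_def)
qed

lemma integrable_mult_of_squares:
  fixes f g :: "'a \<Rightarrow> real"
  assumes [measurable]: "f \<in> borel_measurable M" "g \<in> borel_measurable M"
    and "integrable M (\<lambda>x. (f x)\<^sup>2)" "integrable M (\<lambda>x. (g x)\<^sup>2)"
  shows "integrable M (\<lambda>x. f x * g x)"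
proof (rule Bochner_Integration.integrable_bound)
  show "integrable M (\<lambda>x. (f x)\<^sup>2 + (g x)\<^sup>2)"
    using assms by simp
  have "\<bar>u * v\<bar> \<le> u\<^sup>2 + v\<^sup>2" for u v :: real
  proof -
    have "2 * \<bar>u\<bar> * \<bar>v\<bar> \<le> \<bar>u\<bar>\<^sup>2 + \<bar>v\<bar>\<^sup>2"
      by (rule sum_squares_bound)
    moreover have "0 \<le> \<bar>u\<bar> * \<bar>v\<bar>"
      by simp
    ultimately show ?thesis
      unfolding abs_mult power2_abs by linarith
  qed
  then show "AE x in M. norm (f x * g x) \<le> norm ((f x)\<^sup>2 + (g x)\<^sup>2)"
    by simp
qed simp

locale hyperbolic_noise =
  fixes M :: "'a measure" and W
  assumes noise: "hyperbolic_white_noise M W"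
begin

sublocale prob_space M
  using noise by (simp add: hyperbolic_white_noise_def)

lemma combination_gaussian:
  "finite J \<Longrightarrow> p ` J \<subseteq> noise_sets \<Longrightarrow> centered_gaussian M (\<lambda>\<omega>. \<Sum>j\<in>J. a j * W (p j) \<omega>)"
  using noise by (intro centered_gaussian_process_family) (auto simp: hyperbolic_white_noise_def)

lemma W_gaussian: "A \<in> noise_sets \<Longrightarrow> centered_gaussian M (W A)"
  using combination_gaussian[of "{0::nat}" "\<lambda>_. A" "\<lambda>_. 1"] by simp

lemma W_measurable [measurable]: "A \<in> noise_sets \<Longrightarrow> W A \<in> borel_measurable M"
  using W_gaussian by (simp add: centered_gaussian_def)

lemma integrable_W_mult:
  "A \<in> noise_sets \<Longrightarrow> B \<in> noise_sets \<Longrightarrow> integrable M (\<lambda>\<omega>. W A \<omega> * W B \<omega>)"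
  by (intro integrable_mult_of_squares W_measurable centered_gaussian_exp_moment W_gaussian prob_space_axioms)

lemma covariance:
  "A \<in> noise_sets \<Longrightarrow> B \<in> noise_sets \<Longrightarrow>
    (\<integral>\<omega>. W A \<omega> * W B \<omega> \<partial>M) = measure hyperbolic_measure (A \<inter> B)"
  using noise by (simp add: hyperbolic_white_noise_def)

lemma combination_variance:
  assumes "finite J" "p ` J \<subseteq> noise_sets"
  shows "(\<integral>\<omega>. (\<Sum>j\<in>J. a j * W (p j) \<omega>)\<^sup>2 \<partial>M) =
    (\<Sum>i\<in>J. \<Sum>j\<in>J. a i * a j * measure hyperbolic_measure (p i \<inter> p j))"
proof -
  have "(\<integral>\<omega>. (\<Sum>j\<in>J. a j * W (p j) \<omega>)\<^sup>2 \<partial>M) =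
    (\<integral>\<omega>. (\<Sum>i\<in>J. \<Sum>j\<in>J. a i * a j * (W (p i) \<omega> * W (p j) \<omega>)) \<partial>M)"
    by (simp add: power2_eq_square sum_product ac_simps)
  also have "\<dots> = (\<Sum>i\<in>J. \<Sum>j\<in>J. a i * a j * (\<integral>\<omega>. W (p i) \<omega> * W (p j) \<omega> \<partial>M))"
    using assms by (simp add: integrable_W_mult image_subset_iff Bochner_Integration.integral_sum)
  also have "\<dots> = (\<Sum>i\<in>J. \<Sum>j\<in>J. a i * a j * measure hyperbolic_measure (p i \<inter> p j))"
    using assms by (auto intro!: sum.cong simp: covariance image_subset_iff)
  finally show ?thesis .
qed

lemma combination_exp:
  assumes "finite J" "p ` J \<subseteq> noise_sets"
  shows "integrable M (\<lambda>\<omega>. exp (\<Sum>j\<in>J. a j * W (p j) \<omega>))"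
    and "(\<integral>\<omega>. exp (\<Sum>j\<in>J. a j * W (p j) \<omega>) \<partial>M) =
      exp ((\<Sum>i\<in>J. \<Sum>j\<in>J. a i * a j * measure hyperbolic_measure (p i \<inter> p j)) / 2)"
  using centered_gaussian_exp_moment(2,3)[OF prob_space_axioms combination_gaussian[OF assms, of a]]
  by (simp_all add: combination_variance[OF assms])

text \<open>Additivity is a consequence of the covariance: \<open>W (A - B) - W A + W B\<close> is a
  centred Gaussian of variance 0.\<close>

lemma W_Diff:
  assumes A: "A \<in> noise_sets" and B: "B \<in> noise_sets" and "B \<subseteq> A"
  shows "AE \<omega> in M. W (A - B) \<omega> = W A \<omega> - W B \<omega>"
proof -
  have fin: "emeasure hyperbolic_measure A < \<infinity>" "emeasure hyperbolic_measure B < \<infinity>"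
    and sets [measurable]: "A \<in> sets hyperbolic_measure" "B \<in> sets hyperbolic_measure"
    using A B by (auto simp: noise_sets_def)
  have "emeasure hyperbolic_measure (A - B) \<le> emeasure hyperbolic_measure A"
    by (intro emeasure_mono) auto
  then have D: "A - B \<in> noise_sets"
    using A B fin by (auto simp: noise_sets_def dest: le_less_trans intro: bounded_subset)
  define p where "p = (\<lambda>i::nat. if i = 0 then A - B else if i = 1 then A else B)"
  define a where "a = (\<lambda>i::nat. if i = 0 then 1 else if i = 1 then -1 else 1 :: real)"
  have p: "p ` {0,1,2} \<subseteq> noise_sets"
    using A B D by (auto simp: p_def)
  have "measure hyperbolic_measure A = measure hyperbolic_measure (A - B) + measure hyperbolic_measure B"
    using assms(3) fin by (subst measure_Diff) (auto intro!: simp: top_unique)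
  moreover have "A \<inter> (A - B) = A - B" "(A - B) \<inter> A = A - B" "A \<inter> B = B" "B \<inter> A = B" "(A - B) \<inter> B = {}" "B \<inter> (A - B) = {}"
    using assms(3) by auto
  ultimately have "(\<integral>\<omega>. (\<Sum>j\<in>{0,1,2}. a j * W (p j) \<omega>)\<^sup>2 \<partial>M) = 0"
    by (subst combination_variance[OF _ p]) (simp_all add: a_def p_def)
  then have "AE \<omega> in M. (\<Sum>j\<in>{0,1,2}. a j * W (p j) \<omega>) = 0"
    using centered_gaussian_exp_moment(4)[OF prob_space_axioms combination_gaussian[OF _ p, of a]] by simp
  then show ?thesis
    by eventually_elim (simp add: a_def p_def algebra_simps)
qed

end

section \<open>Hyperbolic areas of the cones\<close>

text \<open>Layer of the cone at \<open>s\<close> between the heights \<open>a\<close> and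
  \<open>b\<close>: the full truncated cone for \<open>b = 1\<close>, and otherwise the set behind
  the difference of two truncated fields. Both \<open>0 < y\<close> and, for \<open>b = 1\<close>,
  \<open>\<bar>x - s\<bar> \<le> 1 / 2\<close> follow from \<open>2 * \<bar>x - s\<bar> < y\<close>
  and \<open>y \<le> b\<close>.\<close>

definition strip :: "real \<Rightarrow> real \<Rightarrow> real \<Rightarrow> (real \<times> real) set" where
  "strip a b s = {(x, y). 2 * \<bar>x - s\<bar> < y \<and> a < y \<and> y \<le> b}"

lemma truncated_cone_eq_strip: "0 < \<epsilon> \<Longrightarrow> truncated_cone \<epsilon> s = strip \<epsilon> 1 s"
  by (auto simp: truncated_cone_def strip_def upper_half_plane_def)

lemma fst_snd_borel_real [measurable]:
  "fst \<in> borel_measurable (borel :: (real \<times> real) measure)"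
  "snd \<in> borel_measurable (borel :: (real \<times> real) measure)"
  by (intro borel_measurable_continuous_onI continuous_intros)+

lemma strip_borel [measurable]: "strip a b s \<in> sets borel"
proof -
  have "strip a b s = {p \<in> space borel. 2 * \<bar>fst p - s\<bar> < snd p \<and> a < snd p \<and> snd p \<le> b}"
    by (auto simp: strip_def)
  also have "\<dots> \<in> sets borel"
    by measurable
  finally show ?thesis .
qed

lemma sets_hyperbolic_measure: "sets hyperbolic_measure = sets (restrict_space borel upper_half_plane)"
  by (simp add: hyperbolic_measure_def cong: sets_restrict_space_cong)

lemma upper_half_plane_borel [measurable]: "upper_half_plane \<in> sets borel"
proof -
  have "upper_half_plane = {p \<in> space borel. 0 < snd p}"
    by (auto simp: upper_half_plane_def)
  also have "\<dots> \<in> sets borel"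
    by measurable
  finally show ?thesis .
qed

lemma strip_sets: "0 \<le> a \<Longrightarrow> strip a b s \<in> sets hyperbolic_measure"
  unfolding sets_hyperbolic_measure
  by (subst sets_restrict_space_iff) (auto simp: strip_def upper_half_plane_def[symmetric], auto simp: upper_half_plane_def)

lemma nn_integral_inverse:
  fixes a b :: real
  assumes "0 < a" "a \<le> b"
  shows "(\<integral>\<^sup>+y. ennreal (1 / y) * indicator {a<..b} y \<partial>lborel) = ennreal (ln (b / a))"
proof -
  have "(\<integral>\<^sup>+y. ennreal (1 / y) * indicator {a<..b} y \<partial>lborel) =
    (\<integral>\<^sup>+y. ennreal (1 / y) * indicator {a..b} y \<partial>lborel)"
    by (intro nn_integral_cong_AE, use AE_lborel_singleton[of a] in eventually_elim)
      (auto simp: indicator_def)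
  also have "\<dots> = ennreal (ln b - ln a)"
    using assms by (intro nn_integral_FTC_Icc)
      (auto intro!: derivative_eq_intros simp: divide_inverse)
  finally show ?thesis
    using assms by (simp add: ln_div)
qed

text \<open>The slice at height y has length y, so the density \<open>1 / y\<^sup>2\<close> leaves
  \<open>1 / y\<close> to be integrated over the heights.\<close>

lemma emeasure_strip:
  assumes "0 < a" "a \<le> b"
  shows "emeasure hyperbolic_measure (strip a b s) = ennreal (ln (b / a))"
proof -
  have "emeasure hyperbolic_measure (strip a b s) =
    (\<integral>\<^sup>+p. ennreal (1 / (snd p)\<^sup>2) * indicator (strip a b s) p \<partial>restrict_space lborel upper_half_plane)"
    using strip_sets[of a b s] assms unfolding hyperbolic_measure_def
    by (subst emeasure_density) (auto intro!: measurable_restrict_space1)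
  also have "\<dots> = (\<integral>\<^sup>+p. ennreal (1 / (snd p)\<^sup>2) * indicator (strip a b s) p * indicator upper_half_plane p \<partial>lborel)"
    by (subst nn_integral_restrict_space) auto
  also have "\<dots> = (\<integral>\<^sup>+p. ennreal (1 / (snd p)\<^sup>2) * indicator (strip a b s) p \<partial>lborel)"
    using assms by (intro nn_integral_cong) (auto simp: indicator_def strip_def upper_half_plane_def)
  also have "\<dots> = (\<integral>\<^sup>+y. \<integral>\<^sup>+x. ennreal (1 / y\<^sup>2) * indicator (strip a b s) (x, y) \<partial>lborel \<partial>lborel)"
  proof -
    have "(\<lambda>p. ennreal (1 / (snd p)\<^sup>2) * indicator (strip a b s) p) \<in> borel_measurable (lborel \<Otimes>\<^sub>M lborel)"
      by (simp add: lborel_prod)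
    from lborel_pair.nn_integral_snd[OF this] show ?thesis
      by (simp add: lborel_prod)
  qed
  also have "\<dots> = (\<integral>\<^sup>+y. ennreal (1 / y) * indicator {a<..b} y \<partial>lborel)"
  proof (intro nn_integral_cong)
    fix y :: real
    show "(\<integral>\<^sup>+x. ennreal (1 / y\<^sup>2) * indicator (strip a b s) (x, y) \<partial>lborel) =
      ennreal (1 / y) * indicator {a<..b} y"
    proof (cases "y \<in> {a<..b}")
      case True
      have "(\<integral>\<^sup>+x. ennreal (1 / y\<^sup>2) * indicator (strip a b s) (x, y) \<partial>lborel) =
        (\<integral>\<^sup>+x. ennreal (1 / y\<^sup>2) * indicator {s - y / 2<..<s + y / 2} x \<partial>lborel)"
        using True by (intro nn_integral_cong) (auto simp: indicator_def strip_def abs_if split: if_splits)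
      also have "\<dots> = ennreal (1 / y\<^sup>2) * ennreal y"
        using True assms by (subst nn_integral_cmult_indicator) auto
      also have "\<dots> = ennreal (1 / y)"
        using True assms by (simp add: ennreal_mult[symmetric] power2_eq_square)
      finally show ?thesis
        using True by simp
    qed (auto simp: strip_def)
  qed
  finally show ?thesis
    by (simp add: nn_integral_inverse[OF assms])
qed

lemma strip_noise_sets:
  assumes "0 < a" "a \<le> b"
  shows "strip a b s \<in> noise_sets"
proof -
  have "fst ` strip a b s \<subseteq> cball s b"
    using assms unfolding strip_def by (auto simp: dist_real_def abs_if split: if_splits)
  then show ?thesis
    using assms strip_sets[of a b s] by (auto simp: noise_sets_def emeasure_strip intro: bounded_subset[OF bounded_cball])
qed

lemma strip_Diff: "a \<le> b \<Longrightarrow> b \<le> c \<Longrightarrow> strip a c s - strip b c s = strip a b s"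
  by (auto simp: strip_def)

lemma strip_mono: "a \<le> b \<Longrightarrow> strip b c s \<subseteq> strip a c s"
  by (auto simp: strip_def)

definition strip_cov :: "real \<Rightarrow> real \<Rightarrow> real \<Rightarrow> real \<Rightarrow> real" where
  "strip_cov a b s t = measure hyperbolic_measure (strip a b s \<inter> strip a b t)"

lemma strip_cov_commute: "strip_cov a b s t = strip_cov a b t s"
  by (simp add: strip_cov_def Int_commute)

lemma strip_cov_nonneg: "0 \<le> strip_cov a b s t"
  by (simp add: strip_cov_def)

lemma strip_cov_self: "0 < a \<Longrightarrow> a \<le> b \<Longrightarrow> strip_cov a b s s = ln (b / a)"
  by (simp add: strip_cov_def measure_def emeasure_strip)

lemma strip_cov_far: "b \<le> \<bar>s - t\<bar> \<Longrightarrow> strip_cov a b s t = 0"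
proof -
  assume "b \<le> \<bar>s - t\<bar>"
  then have "strip a b s \<inter> strip a b t = {}"
    unfolding strip_def by (auto, smt (verit))
  then show ?thesis
    by (simp add: strip_cov_def)
qed

text \<open>By the triangle inequality a point common to both strips has height above
  \<open>\<bar>s - t\<bar>\<close>. The intersection thus lies in a layer that starts there, and the
  bound is free of \<open>a\<close>.\<close>

lemma strip_cov_near:
  assumes "0 < a" "0 < \<bar>s - t\<bar>" "\<bar>s - t\<bar> \<le> b"
  shows "strip_cov a b s t \<le> ln (b / \<bar>s - t\<bar>)"
proof -
  have "strip_cov a b s t \<le> measure hyperbolic_measure (strip \<bar>s - t\<bar> b s)"
    unfolding strip_cov_def
  proof (intro measure_mono_fmeasurable fmeasurableI sets.Int strip_sets)
    show "strip a b s \<inter> strip a b t \<subseteq> strip \<bar>s - t\<bar> b s"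
      by (auto simp: strip_def abs_if split: if_splits)
  qed (use assms in \<open>simp_all add: emeasure_strip\<close>)
  also have "\<dots> = ln (b / \<bar>s - t\<bar>)"
    using assms by (simp add: measure_def emeasure_strip)
  finally show ?thesis .
qed

section \<open>Sums and Riemann sums\<close>

lemma sum_four_product:
  fixes f g h k :: "_ \<Rightarrow> real"
  shows "sum f A * sum g B * sum h C * sum k D =
    (\<Sum>a\<in>A. \<Sum>b\<in>B. \<Sum>c\<in>C. \<Sum>d\<in>D. f a * g b * h c * k d)"
  by (simp only: sum_distrib_left[symmetric] sum_distrib_right[symmetric])

text \<open>If no index is isolated, the four indices match up in pairs. There are three pairings
  with \<open>K\<^sup>2\<close> choices each; constant quadruples are counted three times, which
  only enlarges the bound.\<close>

lemma sum_unpaired_indices_bound: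
  fixes a :: "nat \<Rightarrow> nat \<Rightarrow> nat \<Rightarrow> nat \<Rightarrow> real"
  assumes bound: "\<And>i j k l. a i j k l \<le> B" and "0 \<le> B"
    and "\<And>i j k l. i \<notin> {j, k, l} \<Longrightarrow> a i j k l = 0"
    and "\<And>i j k l. j \<notin> {i, k, l} \<Longrightarrow> a i j k l = 0"
    and "\<And>i j k l. k \<notin> {i, j, l} \<Longrightarrow> a i j k l = 0"
    and "\<And>i j k l. l \<notin> {i, j, k} \<Longrightarrow> a i j k l = 0"
  shows "(\<Sum>i<K. \<Sum>j<K. \<Sum>k<K. \<Sum>l<K. a i j k l) \<le> 3 * (real K)\<^sup>2 * B"
proof -
  have delta: "(\<Sum>j<K. of_bool (i = j)) = (1 :: real)" if "i < K" for i
    using that by (subst sum.mono_neutral_right[of _ "{i}"]) auto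
  have "a i j k l \<le> B * (of_bool (i = j) * of_bool (k = l) + of_bool (i = k) * of_bool (j = l)
      + of_bool (i = l) * of_bool (j = k))" for i j k l
  proof (cases "i = j \<and> k = l \<or> i = k \<and> j = l \<or> i = l \<and> j = k")
    case True
    then have "1 \<le> (of_bool (i = j) * of_bool (k = l) + of_bool (i = k) * of_bool (j = l)
      + of_bool (i = l) * of_bool (j = k) :: real)"
      by auto
    then show ?thesis
      using bound[of i j k l] \<open>0 \<le> B\<close> mult_left_mono[of 1 _ B] by fastforce
  next
    case False
    then have "i \<notin> {j, k, l} \<or> j \<notin> {i, k, l} \<or> k \<notin> {i, j, l} \<or> l \<notin> {i, j, k}"
      by auto
    then have "a i j k l = 0"
      by (elim disjE assms(3-6))
    then show ?thesis
      using \<open>0 \<le> B\<close> by simp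
  qed
  then have "(\<Sum>i<K. \<Sum>j<K. \<Sum>k<K. \<Sum>l<K. a i j k l) \<le> (\<Sum>i<K. \<Sum>j<K. \<Sum>k<K. \<Sum>l<K.
      B * (of_bool (i = j) * of_bool (k = l) + of_bool (i = k) * of_bool (j = l)
      + of_bool (i = l) * of_bool (j = k)))"
    by (intro sum_mono)
  also have "\<dots> = (\<Sum>i<K. \<Sum>j<K. \<Sum>k<K. \<Sum>l<K. B * (of_bool (i = j) * of_bool (k = l)))
    + (\<Sum>i<K. \<Sum>j<K. \<Sum>k<K. \<Sum>l<K. B * (of_bool (i = k) * of_bool (j = l)))
    + (\<Sum>i<K. \<Sum>j<K. \<Sum>k<K. \<Sum>l<K. B * (of_bool (i = l) * of_bool (j = k)))"
    by (simp only: distrib_left sum.distrib)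
  also have "\<dots> = B * (\<Sum>i<K. \<Sum>j<K. of_bool (i = j) * (\<Sum>k<K. \<Sum>l<K. of_bool (k = l)))
    + B * (\<Sum>i<K. \<Sum>j<K. \<Sum>k<K. of_bool (i = k) * (\<Sum>l<K. of_bool (j = l)))
    + B * (\<Sum>i<K. \<Sum>j<K. \<Sum>k<K. (\<Sum>l<K. of_bool (i = l)) * of_bool (j = k))"
    by (simp only: sum_distrib_left sum_distrib_right)
  also have "\<dots> = B * (\<Sum>i<K. \<Sum>j<K. of_bool (i = j) * real K)
    + B * (\<Sum>i<K. \<Sum>j<K. \<Sum>k<K. of_bool (i = k))
    + B * (\<Sum>i<K. \<Sum>j<K. \<Sum>k<K. of_bool (j = k))"
    by (intro arg_cong2[of _ _ _ _ "(+)"] arg_cong2[of _ _ _ _ "(*)"] sum.cong) (simp_all add: delta)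
  also have "\<dots> = 3 * (real K)\<^sup>2 * B"
    by (simp add: delta sum_distrib_right[symmetric] power2_eq_square)
  finally show ?thesis .
qed

text \<open>Comparison with the integral of the inverse square root on both sides of
  \<open>j\<close>. The summand \<open>i = j\<close> is \<open>1 / sqrt 0\<close>, that is 0, so the
  diagonal has to be counted separately.\<close>

lemma sum_inverse_sqrt_dist:
  assumes "j < N"
  shows "(\<Sum>i<N. 1 / sqrt \<bar>real j - real i\<bar>) \<le> 4 * sqrt (real N)"
proof -
  \<comment> \<open>A discrete antiderivative glued from two square roots. It vanishes at
    \<open>j\<close> and at \<open>Suc j\<close>, so its increment at \<open>i = j\<close> is 0,
    matching the default value of that summand.\<close>
  define g where "g = (\<lambda>i. if i \<le> j then - 2 * sqrt (real j - real i) else 2 * sqrt (real i - 1 - real j))"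
  have step: "1 / sqrt y \<le> 2 * sqrt y - 2 * sqrt (y - 1)" if "1 \<le> y" for y :: real
  proof -
    have "(sqrt y - sqrt (y - 1)) * (sqrt y + sqrt (y - 1)) = 1"
      using that by (simp add: algebra_simps flip: power2_eq_square)
    moreover have "sqrt (y - 1) \<le> sqrt y" "0 < sqrt y" "0 \<le> sqrt (y - 1)"
      using that by auto
    moreover have "(sqrt y - sqrt (y - 1)) * (sqrt y + sqrt (y - 1)) \<le> (sqrt y - sqrt (y - 1)) * (2 * sqrt y)"
      using that by (intro mult_left_mono) auto
    ultimately have "1 \<le> (2 * sqrt y - 2 * sqrt (y - 1)) * sqrt y"
      by (simp add: algebra_simps)
    then show ?thesis
      using that by (subst divide_le_eq) auto
  qed
  have "1 / sqrt \<bar>real j - real i\<bar> \<le> g (Suc i) - g i" for i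
  proof -
    consider "i < j" | "i = j" | "j < i"
      by linarith
    then show ?thesis
    proof cases
      case 1
      then show ?thesis
        using step[of "real j - real i"] by (simp add: g_def algebra_simps)
    next
      case 2
      then show ?thesis
        by (simp add: g_def)
    next
      case 3
      then show ?thesis
        using step[of "real i - real j"] by (simp add: g_def algebra_simps)
    qed
  qed
  then have "(\<Sum>i<N. 1 / sqrt \<bar>real j - real i\<bar>) \<le> (\<Sum>i<N. g (Suc i) - g i)"
    by (intro sum_mono)
  also have "\<dots> = g N - g 0"
    by (rule sum_lessThan_telescope)
  also have "\<dots> \<le> 2 * sqrt (real N) + 2 * sqrt (real N)"
  proof -
    have "sqrt (real N - 1 - real j) \<le> sqrt (real N)" "sqrt (real j) \<le> sqrt (real N)"
      using assms by auto
    moreover have "g N - g 0 = 2 * sqrt (real N - 1 - real j) + 2 * sqrt (real j)"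
      using assms by (simp add: g_def)
    ultimately show ?thesis
      by linarith
  qed
  finally show ?thesis
    by simp
qed

text \<open>Transfers moment bounds and measurability from finite grids to integrals over continuous
  paths.\<close>

lemma left_Riemann_sums_tendsto:
  fixes f :: "real \<Rightarrow> real"
  assumes cont: "continuous_on UNIV f" and "0 < r"
  shows "(\<lambda>n. (\<Sum>j<Suc n. f (b + r * real j / real (Suc n))) / real (Suc n))
    \<longlonglongrightarrow> integral {b..b + r} f / r"
proof (rule LIMSEQ_I)
  fix e :: real
  assume "0 < e"
  have "uniformly_continuous_on {b..b + r} f"
    using cont by (intro compact_uniformly_continuous) (auto intro: continuous_on_subset)
  then obtain d where "0 < d" and d: "\<And>x y. x \<in> {b..b + r} \<Longrightarrow> y \<in> {b..b + r} \<Longrightarrow> dist y x < d \<Longrightarrow> dist (f y) (f x) < e / 2"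
    using \<open>0 < e\<close> unfolding uniformly_continuous_on_def by (auto dest: spec[of _ "e / 2"])
  obtain N where N: "r / d < real N"
    using reals_Archimedean2 by blast
  define F where "F = (\<lambda>x. integral {b..x} f)"
  have deriv: "(F has_real_derivative f x) (at x within {b..b + r})" if "x \<in> {b..b + r}" for x
    unfolding F_def using that cont
    by (intro integral_has_real_derivative) (auto intro: continuous_on_subset)
  have "\<bar>(\<Sum>j<Suc n. f (b + r * real j / real (Suc n))) / real (Suc n) - integral {b..b + r} f / r\<bar> < e"
    if "N \<le> n" for n
  proof -
    define h where "h = r / real (Suc n)"
    have "0 < h"
      using \<open>0 < r\<close> by (simp add: h_def)
    have "h < d"
    proof -
      have "r / d < real (Suc n)"
        using N that by linarith
      then show ?thesis
        using \<open>0 < d\<close> by (simp add: h_def field_simps)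
    qed
    have top: "b + real j * h \<le> b + r" if "j \<le> Suc n" for j
    proof -
      have "real j * h \<le> real (Suc n) * h"
        using that \<open>0 < h\<close> by (intro mult_right_mono) auto
      then show ?thesis
        by (simp add: h_def)
    qed
    \<comment> \<open>The mean value theorem turns the error on one cell into the oscillation of
      \<open>f\<close> there, which uniform continuity controls.\<close>
    have step: "\<bar>F (b + real (Suc j) * h) - F (b + real j * h) - h * f (b + real j * h)\<bar> \<le> h * (e / 2)"
      if "j < Suc n" for j
    proof -
      define x where "x = b + real j * h"
      have Suc_x: "b + real (Suc j) * h = x + h"
        by (simp add: x_def algebra_simps)
      have x: "b \<le> x" "x + h \<le> b + r"
        using top[of "Suc j"] that \<open>0 < h\<close> by (auto simp: x_def algebra_simps)
      have "\<exists>z\<in>{x<..<x + h}. F (x + h) - F x = (\<lambda>y. f z * y) (x + h - x)"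
      proof (rule mvt_simple)
        fix y
        assume "x \<le> y" "y \<le> x + h"
        then have "(F has_real_derivative f y) (at y within {x..x + h})"
          using x by (intro DERIV_subset[OF deriv]) auto
        then show "(F has_derivative (\<lambda>z. f y * z)) (at y within {x..x + h})"
          by (simp add: has_field_derivative_def)
      qed (use \<open>0 < h\<close> in simp)
      then obtain z where z: "x < z" "z < x + h" "F (x + h) - F x = h * f z"
        by (auto simp: mult.commute)
      have "dist (f z) (f x) < e / 2"
        using x z \<open>h < d\<close> by (intro d) (auto simp: dist_real_def)
      then have "h * \<bar>f z - f x\<bar> \<le> h * (e / 2)"
        using \<open>0 < h\<close> by (intro mult_left_mono) (auto simp: dist_real_def)
      then show ?thesis
        unfolding Suc_x z(3) x_def[symmetric] using \<open>0 < h\<close>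
        by (simp add: abs_mult right_diff_distrib[symmetric])
    qed
    have "F (b + r) - F b = (\<Sum>j<Suc n. F (b + real (Suc j) * h) - F (b + real j * h))"
      by (subst sum_lessThan_telescope) (simp add: h_def)
    then have "\<bar>integral {b..b + r} f - h * (\<Sum>j<Suc n. f (b + real j * h))\<bar> =
      \<bar>\<Sum>j<Suc n. (F (b + real (Suc j) * h) - F (b + real j * h) - h * f (b + real j * h))\<bar>"
      by (simp add: F_def sum_subtractf sum_distrib_left del: sum.lessThan_Suc of_nat_Suc)
    also have "\<dots> \<le> (\<Sum>j<Suc n. h * (e / 2))"
      using step by (intro order_trans[OF sum_abs] sum_mono) auto
    also have "\<dots> = r * (e / 2)"
      by (simp add: h_def del: of_nat_Suc)
    finally have "\<bar>integral {b..b + r} f - h * (\<Sum>j<Suc n. f (b + real j * h))\<bar> / r \<le> e / 2"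
      using \<open>0 < r\<close> by (simp add: divide_le_eq mult.commute)
    also have "\<bar>integral {b..b + r} f - h * (\<Sum>j<Suc n. f (b + real j * h))\<bar> / r =
      \<bar>(integral {b..b + r} f - h * (\<Sum>j<Suc n. f (b + real j * h))) / r\<bar>"
      using \<open>0 < r\<close> by simp
    also have "(integral {b..b + r} f - h * (\<Sum>j<Suc n. f (b + real j * h))) / r =
      integral {b..b + r} f / r - (\<Sum>j<Suc n. f (b + r * real j / real (Suc n))) / real (Suc n)"
      using \<open>0 < r\<close> by (simp add: h_def diff_divide_distrib mult.commute del: of_nat_Suc sum.lessThan_Suc)
    finally show ?thesis
      using \<open>0 < e\<close> by linarith
  qed
  then show "\<exists>no. \<forall>n\<ge>no. norm ((\<Sum>j<Suc n. f (b + r * real j / real (Suc n))) / real (Suc n) - integral {b..b + r} f / r) < e"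
    by auto
qed

section \<open>Correlations of the chaos density\<close>

text \<open>Here \<open>a\<close> is the truncation level and \<open>r\<close> the correlation
  range. The two instances are a truncated field, with \<open>r = 1\<close>, and the difference of
  two truncated fields, with small \<open>r\<close>.\<close>

locale strip_field = hyperbolic_noise M W for M :: "'a measure" and W +
  fixes Y :: "real \<Rightarrow> 'a \<Rightarrow> real" and \<gamma> a r :: real
  assumes \<gamma>: "0 < \<gamma>" "12 * \<gamma>\<^sup>2 \<le> 1"
    and ar: "0 < a" "a \<le> r"
    and Y_measurable [measurable]: "Y s \<in> borel_measurable M"
    and Y_eq: "AE \<omega> in M. Y s \<omega> = W (strip a r s) \<omega>"
    and Y_continuous: "\<omega> \<in> space M \<Longrightarrow> continuous_on UNIV (\<lambda>s. Y s \<omega>)"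
begin

text \<open>The variance of \<open>Y s\<close> is \<open>ln (r / a)\<close>, so this Wick
  exponential has mean 1.\<close>

definition wick_exp :: "real \<Rightarrow> 'a \<Rightarrow> real" where
  "wick_exp s \<omega> = exp (\<gamma> * Y s \<omega> - \<gamma>\<^sup>2 / 2 * ln (r / a))"

lemma wick_exp_measurable [measurable]: "wick_exp s \<in> borel_measurable M"
  by (simp add: wick_exp_def[abs_def])

lemma wick_exp_pos: "0 < wick_exp s \<omega>"
  by (simp add: wick_exp_def)

lemma wick_exp_continuous: "\<omega> \<in> space M \<Longrightarrow> continuous_on A (\<lambda>s. wick_exp s \<omega>)"
  unfolding wick_exp_def by (intro continuous_intros continuous_on_subset[OF Y_continuous]) auto

text \<open>The normalisation cancels exactly the diagonal of the covariance matrix. Distinctness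
  concerns indices, not points, so repeated points are covered.\<close>

lemma prod_wick_exp:
  assumes "finite J"
  shows "integrable M (\<lambda>\<omega>. \<Prod>j\<in>J. wick_exp (p j) \<omega>)"
    and "(\<integral>\<omega>. (\<Prod>j\<in>J. wick_exp (p j) \<omega>) \<partial>M) =
      exp (\<gamma>\<^sup>2 / 2 * (\<Sum>i\<in>J. \<Sum>j\<in>J - {i}. strip_cov a r (p i) (p j)))"
proof -
  define v where "v = ln (r / a)"
  let ?p = "\<lambda>j. strip a r (p j)"
  let ?E = "\<lambda>\<omega>. exp (\<Sum>j\<in>J. \<gamma> * W (?p j) \<omega>)"
  have p: "?p ` J \<subseteq> noise_sets"
    using strip_noise_sets[OF ar] by auto
  note [measurable] = W_measurable[OF strip_noise_sets[OF ar]]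
  have "AE \<omega> in M. \<forall>j\<in>J. Y (p j) \<omega> = W (?p j) \<omega>"
    using assms Y_eq by (simp add: AE_finite_all)
  then have AE: "AE \<omega> in M. (\<Prod>j\<in>J. wick_exp (p j) \<omega>) = exp (- (real (card J) * (\<gamma>\<^sup>2 / 2 * v))) * ?E \<omega>"
    by eventually_elim
      (simp add: wick_exp_def v_def assms flip: exp_sum exp_add, simp add: sum_subtractf)
  have *: "integrable M (\<lambda>\<omega>. exp (- (real (card J) * (\<gamma>\<^sup>2 / 2 * v))) * ?E \<omega>)"
    using combination_exp(1)[OF assms p, of "\<lambda>_. \<gamma>"] by simp
  show "integrable M (\<lambda>\<omega>. \<Prod>j\<in>J. wick_exp (p j) \<omega>)"
    by (rule integrable_cong_AE_imp[OF *]) (use AE in auto)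
  have "(\<integral>\<omega>. (\<Prod>j\<in>J. wick_exp (p j) \<omega>) \<partial>M) =
      exp (- (real (card J) * (\<gamma>\<^sup>2 / 2 * v))) * (\<integral>\<omega>. ?E \<omega> \<partial>M)"
    by (subst integral_cong_AE[OF _ _ AE]) auto
  also have "(\<integral>\<omega>. ?E \<omega> \<partial>M) = exp (\<gamma>\<^sup>2 / 2 * (\<Sum>i\<in>J. \<Sum>j\<in>J. strip_cov a r (p i) (p j)))"
    by (subst combination_exp(2)[OF assms p])
      (simp add: strip_cov_def power2_eq_square flip: sum_distrib_left)
  also have "(\<Sum>i\<in>J. \<Sum>j\<in>J. strip_cov a r (p i) (p j)) =
      (\<Sum>i\<in>J. v + (\<Sum>j\<in>J - {i}. strip_cov a r (p i) (p j)))"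
    using assms ar by (intro sum.cong) (auto simp: sum.remove strip_cov_self v_def)
  also have "\<dots> = real (card J) * v + (\<Sum>i\<in>J. \<Sum>j\<in>J - {i}. strip_cov a r (p i) (p j))"
    by (simp add: sum.distrib)
  finally show "(\<integral>\<omega>. (\<Prod>j\<in>J. wick_exp (p j) \<omega>) \<partial>M) =
      exp (\<gamma>\<^sup>2 / 2 * (\<Sum>i\<in>J. \<Sum>j\<in>J - {i}. strip_cov a r (p i) (p j)))"
    by (simp add: algebra_simps flip: exp_add)
qed

lemma prod_centered_expand:
  assumes "finite J"
  shows "(\<Prod>j\<in>J. wick_exp (p j) \<omega> - 1) = (\<Sum>S\<in>Pow J. (\<Prod>j\<in>S. wick_exp (p j) \<omega>) * (- 1) ^ card (J - S))"
  using prod_add[OF assms, of "\<lambda>j. wick_exp (p j) \<omega>" "\<lambda>_. - 1"] by (simp add: prod_constant)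

lemma integrable_prod_centered:
  assumes "finite J"
  shows "integrable M (\<lambda>\<omega>. \<Prod>j\<in>J. wick_exp (p j) \<omega> - 1)"
  unfolding prod_centered_expand[OF assms]
  by (intro Bochner_Integration.integrable_sum integrable_mult_left prod_wick_exp(1))
    (auto intro: finite_subset[OF _ assms])

text \<open>Takes the place of independence. A factor uncorrelated with the others does not change
  the expectation of a product of Wick exponentials, so in the expansion over subsets the terms with
  and without \<open>i\<close> cancel.\<close>

lemma prod_centered_isolated:
  assumes "finite J" "i \<notin> J" "\<And>j. j \<in> J \<Longrightarrow> strip_cov a r (p i) (p j) = 0"
  shows "(\<integral>\<omega>. (\<Prod>j\<in>insert i J. wick_exp (p j) \<omega> - 1) \<partial>M) = 0"
proof -
  have S: "finite S \<and> i \<notin> S" if "S \<in> Pow J" for S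
    using that assms(1,2) by (auto intro: finite_subset)
  have eq: "(\<integral>\<omega>. (\<Prod>j\<in>insert i S. wick_exp (p j) \<omega>) \<partial>M) = (\<integral>\<omega>. (\<Prod>j\<in>S. wick_exp (p j) \<omega>) \<partial>M)"
    if "S \<in> Pow J" for S
  proof -
    have 0: "strip_cov a r (p i) (p j) = 0" "strip_cov a r (p j) (p i) = 0" if "j \<in> S" for j
      using that \<open>S \<in> Pow J\<close> assms(3)[of j] strip_cov_commute by auto
    have "(\<Sum>k\<in>S. \<Sum>j\<in>insert i S - {k}. strip_cov a r (p k) (p j)) =
      (\<Sum>k\<in>S. \<Sum>j\<in>S - {k}. strip_cov a r (p k) (p j))"
    proof (rule sum.cong[OF refl])
      fix k
      assume "k \<in> S"
      then have "insert i S - {k} = insert i (S - {k})"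
        using S[OF that] by auto
      then show "(\<Sum>j\<in>insert i S - {k}. strip_cov a r (p k) (p j)) =
          (\<Sum>j\<in>S - {k}. strip_cov a r (p k) (p j))"
        using S[OF that] 0 \<open>k \<in> S\<close> by simp
    qed
    moreover have "insert i S - {i} = S"
      using S[OF that] by auto
    ultimately show ?thesis
      using S[OF that] 0 by (subst (1 2) prod_wick_exp(2)) auto
  qed
  have "(\<Prod>j\<in>insert i J. wick_exp (p j) \<omega> - 1) =
      (\<Sum>S\<in>Pow J. ((\<Prod>j\<in>insert i S. wick_exp (p j) \<omega>) - (\<Prod>j\<in>S. wick_exp (p j) \<omega>)) * (- 1) ^ card (J - S))" for \<omega>
  proof -
    have "(\<Prod>j\<in>insert i J. wick_exp (p j) \<omega> - 1) = (wick_exp (p i) \<omega> - 1) * (\<Prod>j\<in>J. wick_exp (p j) \<omega> - 1)"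
      using assms by simp
    also have "\<dots> = (\<Sum>S\<in>Pow J. (wick_exp (p i) \<omega> - 1) * ((\<Prod>j\<in>S. wick_exp (p j) \<omega>) * (- 1) ^ card (J - S)))"
      by (simp add: prod_centered_expand[OF assms(1)] sum_distrib_left)
    also have "\<dots> = (\<Sum>S\<in>Pow J. ((\<Prod>j\<in>insert i S. wick_exp (p j) \<omega>) - (\<Prod>j\<in>S. wick_exp (p j) \<omega>)) * (- 1) ^ card (J - S))"
      using S by (intro sum.cong) (auto simp: algebra_simps)
    finally show ?thesis .
  qed
  then have "(\<integral>\<omega>. (\<Prod>j\<in>insert i J. wick_exp (p j) \<omega> - 1) \<partial>M) =
      (\<Sum>S\<in>Pow J. ((\<integral>\<omega>. (\<Prod>j\<in>insert i S. wick_exp (p j) \<omega>) \<partial>M) - (\<integral>\<omega>. (\<Prod>j\<in>S. wick_exp (p j) \<omega>) \<partial>M)) * (- 1) ^ card (J - S))"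
    using S by (simp add: Bochner_Integration.integral_sum prod_wick_exp(1) Bochner_Integration.integral_diff del: prod.insert)
  then show ?thesis
    using eq by simp
qed

text \<open>Positivity of \<open>wick_exp\<close> bounds each centred factor by
  \<open>wick_exp (p j) \<omega> + 1\<close>. Expanding gives \<open>2 ^ card J\<close> products,
  whose expectations grow with the subset because covariances are nonnegative.\<close>

lemma prod_centered_bound:
  assumes "finite J"
  shows "\<bar>\<integral>\<omega>. (\<Prod>j\<in>J. wick_exp (p j) \<omega> - 1) \<partial>M\<bar> \<le>
    2 ^ card J * exp (\<gamma>\<^sup>2 / 2 * (\<Sum>i\<in>J. \<Sum>j\<in>J - {i}. strip_cov a r (p i) (p j)))"
proof -
  have fin: "finite S" if "S \<in> Pow J" for S
    using that assms by (auto intro: finite_subset)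
  have expand: "(\<Prod>j\<in>J. wick_exp (p j) \<omega> + 1) = (\<Sum>S\<in>Pow J. \<Prod>j\<in>S. wick_exp (p j) \<omega>)" for \<omega>
    by (subst prod_add[OF assms]) simp
  have "\<bar>\<integral>\<omega>. (\<Prod>j\<in>J. wick_exp (p j) \<omega> - 1) \<partial>M\<bar> \<le> (\<integral>\<omega>. \<bar>\<Prod>j\<in>J. wick_exp (p j) \<omega> - 1\<bar> \<partial>M)"
    by (rule integral_abs_bound)
  also have "\<dots> \<le> (\<integral>\<omega>. (\<Prod>j\<in>J. wick_exp (p j) \<omega> + 1) \<partial>M)"
  proof (rule integral_mono)
    show "integrable M (\<lambda>\<omega>. \<bar>\<Prod>j\<in>J. wick_exp (p j) \<omega> - 1\<bar>)"
      using integrable_prod_centered[OF assms] by simp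
    show "integrable M (\<lambda>\<omega>. \<Prod>j\<in>J. wick_exp (p j) \<omega> + 1)"
      unfolding expand by (intro Bochner_Integration.integrable_sum prod_wick_exp(1) fin)
    show "\<bar>\<Prod>j\<in>J. wick_exp (p j) \<omega> - 1\<bar> \<le> (\<Prod>j\<in>J. wick_exp (p j) \<omega> + 1)" for \<omega>
      unfolding abs_prod
    proof (intro prod_mono conjI)
      show "\<bar>wick_exp (p j) \<omega> - 1\<bar> \<le> wick_exp (p j) \<omega> + 1" for j
        using wick_exp_pos[of "p j" \<omega>] by auto
    qed simp
  qed
  also have "\<dots> = (\<Sum>S\<in>Pow J. \<integral>\<omega>. (\<Prod>j\<in>S. wick_exp (p j) \<omega>) \<partial>M)"
    unfolding expand by (intro Bochner_Integration.integral_sum prod_wick_exp(1) fin)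
  also have "\<dots> \<le> (\<Sum>S\<in>Pow J. exp (\<gamma>\<^sup>2 / 2 * (\<Sum>i\<in>J. \<Sum>j\<in>J - {i}. strip_cov a r (p i) (p j))))"
  proof (intro sum_mono)
    fix S
    assume "S \<in> Pow J"
    then have "(\<Sum>i\<in>S. \<Sum>j\<in>S - {i}. strip_cov a r (p i) (p j)) \<le>
        (\<Sum>i\<in>J. \<Sum>j\<in>J - {i}. strip_cov a r (p i) (p j))"
      using assms
      by (intro order_trans[OF sum_mono[OF sum_mono2] sum_mono2])
        (auto intro!: strip_cov_nonneg sum_nonneg)
    then show "(\<integral>\<omega>. (\<Prod>j\<in>S. wick_exp (p j) \<omega>) \<partial>M) \<le>
        exp (\<gamma>\<^sup>2 / 2 * (\<Sum>i\<in>J. \<Sum>j\<in>J - {i}. strip_cov a r (p i) (p j)))"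
      using fin[OF \<open>S \<in> Pow J\<close>] by (simp add: prod_wick_exp(2) mult_left_mono)
  qed
  also have "\<dots> = 2 ^ card J * exp (\<gamma>\<^sup>2 / 2 * (\<Sum>i\<in>J. \<Sum>j\<in>J - {i}. strip_cov a r (p i) (p j)))"
    using assms by (simp add: card_Pow)
  finally show ?thesis .
qed

text \<open>The factor 6 is the number of pairs among four points; it appears when convexity splits
  the joint exponent into one exponential per pair.\<close>

definition pair_weight :: "real \<Rightarrow> real \<Rightarrow> real" where
  "pair_weight s t = exp (6 * \<gamma>\<^sup>2 * strip_cov a r s t)"

lemma four_point:
  shows "integrable M (\<lambda>\<omega>. (wick_exp s \<omega> - 1) * (wick_exp t \<omega> - 1) * (wick_exp u \<omega> - 1) * (wick_exp w \<omega> - 1))"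
    and "\<bar>\<integral>\<omega>. (wick_exp s \<omega> - 1) * (wick_exp t \<omega> - 1) * (wick_exp u \<omega> - 1) * (wick_exp w \<omega> - 1) \<partial>M\<bar> \<le>
      16 / 6 * (pair_weight s t + pair_weight s u + pair_weight s w + pair_weight t u + pair_weight t w + pair_weight u w)"
    and "strip_cov a r s t = 0 \<Longrightarrow> strip_cov a r s u = 0 \<Longrightarrow> strip_cov a r s w = 0 \<Longrightarrow>
      (\<integral>\<omega>. (wick_exp s \<omega> - 1) * (wick_exp t \<omega> - 1) * (wick_exp u \<omega> - 1) * (wick_exp w \<omega> - 1) \<partial>M) = 0"
proof -
  \<comment> \<open>Indexing by \<open>{0, 1, 2, 3}\<close> keeps coinciding points apart as
    factors; index 0 is the point that may be isolated.\<close>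
  define p where "p = (!) [s, t, u, w]"
  define J :: "nat set" where "J = {1, 2, 3}"
  have "(wick_exp s \<omega> - 1) * (wick_exp t \<omega> - 1) * (wick_exp u \<omega> - 1) * (wick_exp w \<omega> - 1) = (\<Prod>j\<in>insert 0 J. wick_exp (p j) \<omega> - 1)" for \<omega>
    by (simp add: J_def p_def)
  note eq = this
  have J: "finite J" "0 \<notin> J" "card (insert 0 J) = 4"
    by (auto simp: J_def)
  show "integrable M (\<lambda>\<omega>. (wick_exp s \<omega> - 1) * (wick_exp t \<omega> - 1) * (wick_exp u \<omega> - 1) * (wick_exp w \<omega> - 1))"
    unfolding eq using J by (intro integrable_prod_centered) auto
  show "strip_cov a r s t = 0 \<Longrightarrow> strip_cov a r s u = 0 \<Longrightarrow> strip_cov a r s w = 0 \<Longrightarrow>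
      (\<integral>\<omega>. (wick_exp s \<omega> - 1) * (wick_exp t \<omega> - 1) * (wick_exp u \<omega> - 1) * (wick_exp w \<omega> - 1) \<partial>M) = 0"
    unfolding eq using J by (intro prod_centered_isolated) (auto simp: J_def p_def)
  define c where "c = (\<lambda>s t. 6 * \<gamma>\<^sup>2 * strip_cov a r s t)"
  have p: "p 0 = s" "p 1 = t" "p (Suc 0) = t" "p 2 = u" "p 3 = w"
    by (simp_all add: p_def numeral_eq_Suc)
  have sets: "insert 0 J - {Suc 0} = {0, 2, 3}" "insert 0 J - {0} = {1, 2, 3}" "insert 0 J - {1} = {0, 2, 3}"
    "insert 0 J - {2} = {0, 1, 3}" "insert 0 J - {3} = {0, 1, 2}"
    by (auto simp: J_def)
  have "\<gamma>\<^sup>2 / 2 * (\<Sum>i\<in>insert 0 J. \<Sum>j\<in>insert 0 J - {i}. strip_cov a r (p i) (p j)) =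
    \<gamma>\<^sup>2 / 2 * (\<Sum>i\<in>{0, 1, 2, 3}. \<Sum>j\<in>insert 0 J - {i}. strip_cov a r (p i) (p j))"
    by (simp add: J_def)
  \<comment> \<open>Each unordered pair occurs twice, which absorbs the 1/2 in
    \<open>\<gamma>\<^sup>2 / 2\<close>.\<close>
  also have "\<dots> = (c s t + c s u + c s w + c t u + c t w + c u w) / 6"
    by (simp add: sets p c_def strip_cov_commute[of a r t s]
      strip_cov_commute[of a r u s] strip_cov_commute[of a r w s] strip_cov_commute[of a r u t]
      strip_cov_commute[of a r w t] strip_cov_commute[of a r w u] algebra_simps)
  finally have sum: "\<gamma>\<^sup>2 / 2 * (\<Sum>i\<in>insert 0 J. \<Sum>j\<in>insert 0 J - {i}. strip_cov a r (p i) (p j)) =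
    (c s t + c s u + c s w + c t u + c t w + c u w) / 6" .
  \<comment> \<open>Jensen's inequality separates the pairs, so that fourfold sums over the grid
    will reduce to double sums.\<close>
  have conv: "exp ((x1 + x2 + x3 + x4 + x5 + x6) / 6) \<le>
      (exp x1 + exp x2 + exp x3 + exp x4 + exp x5 + exp x6) / 6" for x1 x2 x3 x4 x5 x6 :: real
  proof -
    define m where "m = (x1 + x2 + x3 + x4 + x5 + x6) / 6"
    \<comment> \<open>Tangent line at the mean \<open>m\<close>; the linear terms cancel when the
      six inequalities are added.\<close>
    have "exp m * (1 + (x - m)) \<le> exp x" for x
      using mult_left_mono[OF exp_ge_add_one_self[of "x - m"], of "exp m"] by (simp flip: exp_add)
    from add_mono[OF add_mono[OF add_mono[OF this[of x1] this[of x2]] add_mono[OF this[of x3] this[of x4]]]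
        add_mono[OF this[of x5] this[of x6]]]
    have "exp m * 6 \<le> exp x1 + exp x2 + exp x3 + exp x4 + exp x5 + exp x6"
      by (simp add: m_def field_simps)
    then show ?thesis
      by (simp add: m_def)
  qed
  have "\<bar>\<integral>\<omega>. (wick_exp s \<omega> - 1) * (wick_exp t \<omega> - 1) * (wick_exp u \<omega> - 1) * (wick_exp w \<omega> - 1) \<partial>M\<bar> \<le>
    16 * exp ((c s t + c s u + c s w + c t u + c t w + c u w) / 6)"
    unfolding eq using prod_centered_bound[of "insert 0 J" p] J unfolding sum by simp
  also have "\<dots> \<le> 16 * ((pair_weight s t + pair_weight s u + pair_weight s w + pair_weight t u + pair_weight t w + pair_weight u w) / 6)"
  proof -
    have "pair_weight x y = exp (c x y)" for x y
      by (simp add: pair_weight_def c_def)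
    then show ?thesis
      by (simp only: mult_left_mono[OF conv] zero_le_numeral)
  qed
  finally show "\<bar>\<integral>\<omega>. (wick_exp s \<omega> - 1) * (wick_exp t \<omega> - 1) * (wick_exp u \<omega> - 1) * (wick_exp w \<omega> - 1) \<partial>M\<bar> \<le>
      16 / 6 * (pair_weight s t + pair_weight s u + pair_weight s w + pair_weight t u + pair_weight t w + pair_weight u w)"
    by simp
qed

end

section \<open>Fourth moment of the block masses\<close>

context strip_field
begin

lemma pair_weight_far: "r \<le> \<bar>s - t\<bar> \<Longrightarrow> pair_weight s t = 1"
  by (simp add: pair_weight_def strip_cov_far)

text \<open>The size of \<gamma> matters here: \<open>6 * \<gamma>\<^sup>2 \<le> 1 / 2\<close> turns
  the logarithmic covariance into an integrable inverse square root.\<close>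

lemma pair_weight_near:
  assumes "0 < \<bar>s - t\<bar>" "\<bar>s - t\<bar> \<le> r"
  shows "pair_weight s t \<le> sqrt (r / \<bar>s - t\<bar>)"
proof -
  have "6 * \<gamma>\<^sup>2 * strip_cov a r s t \<le> 1 / 2 * ln (r / \<bar>s - t\<bar>)"
    using \<gamma> ar assms by (intro mult_mono strip_cov_near strip_cov_nonneg) auto
  also have "\<dots> = ln (sqrt (r / \<bar>s - t\<bar>))"
    using ar assms by (subst ln_sqrt) auto
  finally have "pair_weight s t \<le> exp (ln (sqrt (r / \<bar>s - t\<bar>)))"
    unfolding pair_weight_def by simp
  also have "\<dots> = sqrt (r / \<bar>s - t\<bar>)"
    using ar assms by (intro exp_ln) auto
  finally show ?thesis .
qed

text \<open>Sample point \<open>j\<close> of block \<open>k\<close>. Blocks have length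
  \<open>r\<close> and start \<open>2 * r\<close> apart, so the gaps also have length
  \<open>r\<close>.\<close>

definition grid_point :: "real \<Rightarrow> nat \<Rightarrow> nat \<Rightarrow> nat \<Rightarrow> real" where
  "grid_point b N k j = b + 2 * r * real k + r * real j / real N"

lemma grid_point_far:
  assumes "k \<noteq> k'" "j < N" "j' < N"
  shows "r \<le> \<bar>grid_point b N k j - grid_point b N k' j'\<bar>"
proof -
  have frac: "0 \<le> r * real i / real N" "r * real i / real N \<le> r" if "i < N" for i
    using that ar by (auto simp: divide_le_eq)
  have "r \<le> grid_point b N k j - grid_point b N k' j'" if "k' < k" "j < N" "j' < N" for k k' j j'
  proof -
    have "2 * r * real k' + 2 * r \<le> 2 * r * real k"
    proof -
      have "real k' + 1 \<le> real k"
        using that by simp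
      then have "2 * r * (real k' + 1) \<le> 2 * r * real k"
        using ar by (intro mult_left_mono) auto
      then show ?thesis
        by (simp add: algebra_simps)
    qed
    then show ?thesis
      using frac[of j] frac[of j'] that unfolding grid_point_def by linarith
  qed
  from this[of k' k j j'] this[of k k' j' j] show ?thesis
    using assms by (cases "k < k'") (auto simp: abs_if)
qed

text \<open>Bounds the average of \<open>pair_weight\<close> over the sample points of two blocks.
  The last term is the diagonal contribution; it alone contains the truncation, and it vanishes as
  \<open>N\<close> grows.\<close>

definition kernel_bound :: "nat \<Rightarrow> real" where
  "kernel_bound N = 5 + exp (6 * \<gamma>\<^sup>2 * ln (r / a)) / real N"

lemma kernel_sum:
  assumes "0 < N"
  shows "(\<Sum>j<N. \<Sum>j'<N. pair_weight (grid_point b N k j) (grid_point b N k' j')) \<le> (real N)\<^sup>2 * kernel_bound N"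
proof (cases "k = k'")
  case False
  have "(\<Sum>j<N. \<Sum>j'<N. pair_weight (grid_point b N k j) (grid_point b N k' j')) = (\<Sum>j<N. \<Sum>j'<N. 1)"
    using False by (intro sum.cong refl pair_weight_far grid_point_far) auto
  also have "\<dots> = (real N)\<^sup>2 * 1"
    by (simp add: power2_eq_square)
  also have "\<dots> \<le> (real N)\<^sup>2 * kernel_bound N"
    by (intro mult_left_mono) (auto simp: kernel_bound_def)
  finally show ?thesis .
next
  case True
  let ?m = "exp (6 * \<gamma>\<^sup>2 * ln (r / a))"
  \<comment> \<open>For \<open>j = j'\<close> the second summand is 0, as division by 0 yields 0.
    For \<open>j \<noteq> j'\<close> only the second one remains, and \<open>r\<close> cancels from
    it.\<close>
  have point: "pair_weight (grid_point b N k j) (grid_point b N k' j') \<le> of_bool (j = j') * ?m + sqrt (real N) * (1 / sqrt \<bar>real j - real j'\<bar>)"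
    if "j < N" "j' < N" for j j'
  proof (cases "j = j'")
    case True
    then show ?thesis
      using \<open>k = k'\<close> ar by (simp add: pair_weight_def strip_cov_self)
  next
    case False
    have "grid_point b N k j - grid_point b N k' j' = r / real N * (real j - real j')"
      using \<open>k = k'\<close> by (simp add: grid_point_def algebra_simps diff_divide_distrib)
    then have dist: "\<bar>grid_point b N k j - grid_point b N k' j'\<bar> = r / real N * \<bar>real j - real j'\<bar>"
      using ar by (simp add: abs_mult)
    moreover have "\<bar>real j - real j'\<bar> \<le> real N"
      using that by linarith
    then have "r / real N * \<bar>real j - real j'\<bar> \<le> r"
      using ar assms by (simp add: divide_le_eq mult.commute)
    moreover have "0 < r / real N * \<bar>real j - real j'\<bar>"
      using ar assms False by simp
    ultimately have "pair_weight (grid_point b N k j) (grid_point b N k' j') \<le> sqrt (r / (r / real N * \<bar>real j - real j'\<bar>))"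
      using pair_weight_near[of "grid_point b N k j" "grid_point b N k' j'"] by simp
    also have "r / (r / real N * \<bar>real j - real j'\<bar>) = real N / \<bar>real j - real j'\<bar>"
      using ar by simp
    finally show ?thesis
      using False by (simp add: real_sqrt_divide)
  qed
  have "(\<Sum>j<N. \<Sum>j'<N. pair_weight (grid_point b N k j) (grid_point b N k' j')) \<le>
    (\<Sum>j<N. \<Sum>j'<N. of_bool (j = j') * ?m + sqrt (real N) * (1 / sqrt \<bar>real j - real j'\<bar>))"
    using point by (intro sum_mono) auto
  also have "\<dots> = (\<Sum>j<N. (\<Sum>j'<N. of_bool (j = j') * ?m) + sqrt (real N) * (\<Sum>j'<N. 1 / sqrt \<bar>real j - real j'\<bar>))"
    by (simp add: sum.distrib sum_distrib_left)
  \<comment> \<open>A row of \<open>N\<close> points costs \<open>4 * N\<close> off the diagonal: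
    the singularity loses only a constant factor.\<close>
  also have "\<dots> \<le> (\<Sum>j<N. ?m + sqrt (real N) * (4 * sqrt (real N)))"
  proof (intro sum_mono add_mono mult_left_mono sum_inverse_sqrt_dist)
    fix j
    assume "j \<in> {..<N}"
    then show "(\<Sum>j'<N. of_bool (j = j') * ?m) \<le> ?m"
      by (subst sum.mono_neutral_right[of _ "{j}"]) auto
  qed auto
  also have "\<dots> = (real N)\<^sup>2 * (4 + ?m / real N)"
    using assms by (simp add: field_simps power2_eq_square)
  also have "\<dots> \<le> (real N)\<^sup>2 * kernel_bound N"
    by (intro mult_left_mono) (auto simp: kernel_bound_def)
  finally show ?thesis .
qed

definition block_fluct :: "real \<Rightarrow> nat \<Rightarrow> nat \<Rightarrow> 'a \<Rightarrow> real" where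
  "block_fluct b N k \<omega> = (\<Sum>j<N. wick_exp (grid_point b N k j) \<omega> - 1) / real N"

lemma block_fluct_measurable [measurable]: "block_fluct b N k \<in> borel_measurable M"
  unfolding block_fluct_def[abs_def] by measurable

lemma block_product:
  shows "integrable M (\<lambda>\<omega>. block_fluct b N k1 \<omega> * block_fluct b N k2 \<omega> * block_fluct b N k3 \<omega> * block_fluct b N k4 \<omega>)"
    and "(\<integral>\<omega>. block_fluct b N k1 \<omega> * block_fluct b N k2 \<omega> * block_fluct b N k3 \<omega> * block_fluct b N k4 \<omega> \<partial>M) =
      (\<Sum>j1<N. \<Sum>j2<N. \<Sum>j3<N. \<Sum>j4<N.
        (\<integral>\<omega>. (wick_exp (grid_point b N k1 j1) \<omega> - 1) * (wick_exp (grid_point b N k2 j2) \<omega> - 1) *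
          (wick_exp (grid_point b N k3 j3) \<omega> - 1) * (wick_exp (grid_point b N k4 j4) \<omega> - 1) \<partial>M)) / real N ^ 4"
proof -
  have eq: "block_fluct b N k1 \<omega> * block_fluct b N k2 \<omega> * block_fluct b N k3 \<omega> * block_fluct b N k4 \<omega> =
    (\<Sum>j1<N. \<Sum>j2<N. \<Sum>j3<N. \<Sum>j4<N.
        (wick_exp (grid_point b N k1 j1) \<omega> - 1) * (wick_exp (grid_point b N k2 j2) \<omega> - 1) *
          (wick_exp (grid_point b N k3 j3) \<omega> - 1) * (wick_exp (grid_point b N k4 j4) \<omega> - 1)) / real N ^ 4" for \<omega>
    unfolding block_fluct_def by (simp add: sum_four_product[symmetric] power4_eq_xxxx)
  show "integrable M (\<lambda>\<omega>. block_fluct b N k1 \<omega> * block_fluct b N k2 \<omega> * block_fluct b N k3 \<omega> * block_fluct b N k4 \<omega>)"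
    unfolding eq by (intro integrable_divide_zero Bochner_Integration.integrable_sum four_point(1))
  show "(\<integral>\<omega>. block_fluct b N k1 \<omega> * block_fluct b N k2 \<omega> * block_fluct b N k3 \<omega> * block_fluct b N k4 \<omega> \<partial>M) =
      (\<Sum>j1<N. \<Sum>j2<N. \<Sum>j3<N. \<Sum>j4<N.
        (\<integral>\<omega>. (wick_exp (grid_point b N k1 j1) \<omega> - 1) * (wick_exp (grid_point b N k2 j2) \<omega> - 1) *
          (wick_exp (grid_point b N k3 j3) \<omega> - 1) * (wick_exp (grid_point b N k4 j4) \<omega> - 1) \<partial>M)) / real N ^ 4"
    unfolding eq by (simp add: Bochner_Integration.integral_sum Bochner_Integration.integrable_sum four_point(1))
qed

lemma block_product_isolated:
  assumes "k1 \<notin> {k2, k3, k4}"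
  shows "(\<integral>\<omega>. block_fluct b N k1 \<omega> * block_fluct b N k2 \<omega> * block_fluct b N k3 \<omega> * block_fluct b N k4 \<omega> \<partial>M) = 0"
proof -
  have "(\<Sum>j1<N. \<Sum>j2<N. \<Sum>j3<N. \<Sum>j4<N.
        (\<integral>\<omega>. (wick_exp (grid_point b N k1 j1) \<omega> - 1) * (wick_exp (grid_point b N k2 j2) \<omega> - 1) *
          (wick_exp (grid_point b N k3 j3) \<omega> - 1) * (wick_exp (grid_point b N k4 j4) \<omega> - 1) \<partial>M)) = 0"
    using assms by (intro sum.neutral ballI four_point(3) strip_cov_far grid_point_far) auto
  then show ?thesis
    by (simp add: block_product)
qed

text \<open>Each weight depends on two of the four sample indices and the other two are free, giving
  \<open>(real N)\<^sup>2\<close>; six pairs times \<open>16 / 6\<close> make 16.\<close>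

lemma block_product_bound:
  assumes "0 < N"
  shows "(\<integral>\<omega>. block_fluct b N k1 \<omega> * block_fluct b N k2 \<omega> * block_fluct b N k3 \<omega> * block_fluct b N k4 \<omega> \<partial>M) \<le> 16 * kernel_bound N"
proof -
  let ?G = "\<lambda>k j k' j'. pair_weight (grid_point b N k j) (grid_point b N k' j')"
  let ?S = "\<lambda>k k'. \<Sum>j<N. \<Sum>j'<N. ?G k j k' j'"
  have "(\<Sum>j1<N. \<Sum>j2<N. \<Sum>j3<N. \<Sum>j4<N.
        (\<integral>\<omega>. (wick_exp (grid_point b N k1 j1) \<omega> - 1) * (wick_exp (grid_point b N k2 j2) \<omega> - 1) *
          (wick_exp (grid_point b N k3 j3) \<omega> - 1) * (wick_exp (grid_point b N k4 j4) \<omega> - 1) \<partial>M)) \<le>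
    (\<Sum>j1<N. \<Sum>j2<N. \<Sum>j3<N. \<Sum>j4<N. 16 / 6 *
      (?G k1 j1 k2 j2 + ?G k1 j1 k3 j3 + ?G k1 j1 k4 j4 + ?G k2 j2 k3 j3 + ?G k2 j2 k4 j4 + ?G k3 j3 k4 j4))"
    by (intro sum_mono order_trans[OF abs_ge_self four_point(2)])
  also have "\<dots> = 16 / 6 * ((real N)\<^sup>2 * (?S k1 k2 + ?S k1 k3 + ?S k1 k4 + ?S k2 k3 + ?S k2 k4 + ?S k3 k4))"
    unfolding sum_distrib_left[symmetric]
    by (simp add: sum.distrib distrib_left power2_eq_square mult.assoc flip: sum_distrib_left)
  also have "\<dots> \<le> 16 / 6 * ((real N)\<^sup>2 * ((real N)\<^sup>2 * kernel_bound N + (real N)\<^sup>2 * kernel_bound N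
      + (real N)\<^sup>2 * kernel_bound N + (real N)\<^sup>2 * kernel_bound N + (real N)\<^sup>2 * kernel_bound N
      + (real N)\<^sup>2 * kernel_bound N))"
    by (intro mult_left_mono add_mono kernel_sum assms) auto
  also have "\<dots> = 16 * kernel_bound N * real N ^ 4"
    by (simp add: power4_eq_xxxx power2_eq_square)
  finally show ?thesis
    unfolding block_product using assms by (simp add: divide_le_eq)
qed

text \<open>Here 48 is 3 pairings of blocks times 16. The order \<open>K\<^sup>2\<close> in place of
  \<open>K ^ 4\<close> is the gain from the vanishing of terms with an isolated block.\<close>

lemma block_fourth_moment:
  assumes "0 < N"
  shows "integrable M (\<lambda>\<omega>. (\<Sum>k<K. block_fluct b N k \<omega>) ^ 4)"
    and "(\<integral>\<omega>. (\<Sum>k<K. block_fluct b N k \<omega>) ^ 4 \<partial>M) \<le> 48 * (real K)\<^sup>2 * kernel_bound N"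
proof -
  have eq: "(\<Sum>k<K. block_fluct b N k \<omega>) ^ 4 =
    (\<Sum>k1<K. \<Sum>k2<K. \<Sum>k3<K. \<Sum>k4<K. block_fluct b N k1 \<omega> * block_fluct b N k2 \<omega> * block_fluct b N k3 \<omega> * block_fluct b N k4 \<omega>)" for \<omega>
    by (simp add: power4_eq_xxxx sum_four_product)
  show "integrable M (\<lambda>\<omega>. (\<Sum>k<K. block_fluct b N k \<omega>) ^ 4)"
    unfolding eq by (intro Bochner_Integration.integrable_sum block_product(1))
  have "(\<integral>\<omega>. (\<Sum>k<K. block_fluct b N k \<omega>) ^ 4 \<partial>M) =
    (\<Sum>k1<K. \<Sum>k2<K. \<Sum>k3<K. \<Sum>k4<K. \<integral>\<omega>. block_fluct b N k1 \<omega> * block_fluct b N k2 \<omega> * block_fluct b N k3 \<omega> * block_fluct b N k4 \<omega> \<partial>M)"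
    unfolding eq by (simp add: Bochner_Integration.integral_sum Bochner_Integration.integrable_sum block_product(1))
  also have "\<dots> \<le> 3 * (real K)\<^sup>2 * (16 * kernel_bound N)"
  proof (rule sum_unpaired_indices_bound)
    fix i j k l :: nat
    show "(\<integral>\<omega>. block_fluct b N i \<omega> * block_fluct b N j \<omega> * block_fluct b N k \<omega> * block_fluct b N l \<omega> \<partial>M) \<le> 16 * kernel_bound N"
      by (rule block_product_bound[OF assms])
    show "0 \<le> 16 * kernel_bound N"
      by (simp add: kernel_bound_def)
    show "(\<integral>\<omega>. block_fluct b N i \<omega> * block_fluct b N j \<omega> * block_fluct b N k \<omega> * block_fluct b N l \<omega> \<partial>M) = 0" if "i \<notin> {j, k, l}"
      using block_product_isolated[OF that] .
    show "(\<integral>\<omega>. block_fluct b N i \<omega> * block_fluct b N j \<omega> * block_fluct b N k \<omega> * block_fluct b N l \<omega> \<partial>M) = 0" if "j \<notin> {i, k, l}"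
      using block_product_isolated[OF that, of b N] by (simp add: ac_simps)
    show "(\<integral>\<omega>. block_fluct b N i \<omega> * block_fluct b N j \<omega> * block_fluct b N k \<omega> * block_fluct b N l \<omega> \<partial>M) = 0" if "k \<notin> {i, j, l}"
      using block_product_isolated[OF that, of b N] by (simp add: ac_simps)
    show "(\<integral>\<omega>. block_fluct b N i \<omega> * block_fluct b N j \<omega> * block_fluct b N k \<omega> * block_fluct b N l \<omega> \<partial>M) = 0" if "l \<notin> {i, j, k}"
      using block_product_isolated[OF that, of b N] by (simp add: ac_simps)
  qed
  finally show "(\<integral>\<omega>. (\<Sum>k<K. block_fluct b N k \<omega>) ^ 4 \<partial>M) \<le> 48 * (real K)\<^sup>2 * kernel_bound N"
    by simp
qed

section \<open>Block masses as limits of grid sums\<close>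

definition mass :: "real \<Rightarrow> real \<Rightarrow> 'a \<Rightarrow> real" where
  "mass b c \<omega> = integral {b..c} (\<lambda>s. wick_exp s \<omega>)"

lemma mass_Riemann:
  assumes "\<omega> \<in> space M" "0 < h"
  shows "(\<lambda>n. (\<Sum>j<Suc n. wick_exp (b + h * real j / real (Suc n)) \<omega>) / real (Suc n)) \<longlonglongrightarrow> mass b (b + h) \<omega> / h"
  unfolding mass_def using assms by (intro left_Riemann_sums_tendsto wick_exp_continuous)

lemma mass_measurable [measurable]: "mass b c \<in> borel_measurable M"
proof (cases "b < c")
  case True
  have "(\<lambda>\<omega>. mass b c \<omega> / (c - b)) \<in> borel_measurable M"
  proof (rule borel_measurable_LIMSEQ_real)
    show "(\<lambda>n. (\<Sum>j<Suc n. wick_exp (b + (c - b) * real j / real (Suc n)) \<omega>) / real (Suc n))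
        \<longlonglongrightarrow> mass b c \<omega> / (c - b)" if "\<omega> \<in> space M" for \<omega>
      using mass_Riemann[OF that, of "c - b" b] True by simp
  qed measurable
  then have "(\<lambda>\<omega>. (c - b) * (mass b c \<omega> / (c - b))) \<in> borel_measurable M"
    by measurable
  then show ?thesis
    using True by simp
next
  case False
  then have "mass b c = (\<lambda>_. 0)"
    by (cases "b = c") (auto simp: mass_def fun_eq_iff)
  then show ?thesis
    by simp
qed

lemma mass_split:
  assumes "\<omega> \<in> space M" "b \<le> c" "c \<le> d"
  shows "mass b d \<omega> = mass b c \<omega> + mass c d \<omega>"
  unfolding mass_def
  by (intro Henstock_Kurzweil_Integration.integral_combine[symmetric] integrable_continuous_real
      wick_exp_continuous assms)

lemma mass_nonneg: "\<omega> \<in> space M \<Longrightarrow> 0 \<le> mass b c \<omega>"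
  unfolding mass_def
  by (intro Henstock_Kurzweil_Integration.integral_nonneg integrable_continuous_real wick_exp_continuous)
    (auto intro: less_imp_le wick_exp_pos)

text \<open>The gaps are dropped; they matter only for decorrelating the blocks, and their mass is
  nonnegative.\<close>

lemma mass_blocks:
  assumes "\<omega> \<in> space M"
  shows "(\<Sum>k<K. mass (b + 2 * r * real k) (b + 2 * r * real k + r) \<omega>) \<le> mass b (b + 2 * r * real K) \<omega>"
proof (induction K)
  case 0
  then show ?case
    by (simp add: mass_def)
next
  case (Suc K)
  let ?c = "b + 2 * r * real K"
  have le: "b \<le> ?c" "?c \<le> ?c + r" "?c + r \<le> b + 2 * r * real (Suc K)"
    using ar by (auto simp: algebra_simps)
  have "mass b (b + 2 * r * real (Suc K)) \<omega> =
    mass b ?c \<omega> + (mass ?c (?c + r) \<omega> + mass (?c + r) (b + 2 * r * real (Suc K)) \<omega>)"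
    using le by (simp only: mass_split[OF assms, of ?c "?c + r" "b + 2 * r * real (Suc K)", symmetric]
        mass_split[OF assms, of b ?c "b + 2 * r * real (Suc K)", symmetric])
  then show ?case
    using Suc mass_nonneg[OF assms, of "?c + r" "b + 2 * r * real (Suc K)"] by simp
qed

text \<open>Fatou's lemma carries the grid bound over to the integrals. The diagonal term of
  \<open>kernel_bound\<close> tends to 0 and leaves \<open>48 * 5 = 240\<close>, free of
  \<open>a\<close> and \<open>r\<close>.\<close>

lemma fluctuation_fourth_moment:
  shows "(\<integral>\<^sup>+\<omega>. ennreal ((\<Sum>k<K. mass (b + 2 * r * real k) (b + 2 * r * real k + r) \<omega> / r - 1) ^ 4) \<partial>M)
    \<le> ennreal (240 * (real K)\<^sup>2)"
proof -
  let ?D = "\<lambda>\<omega>. \<Sum>k<K. mass (b + 2 * r * real k) (b + 2 * r * real k + r) \<omega> / r - 1"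
  let ?Dn = "\<lambda>n \<omega>. \<Sum>k<K. block_fluct b (Suc n) k \<omega>"
  have r: "0 < r"
    using ar by simp
  have lim: "(\<lambda>n. ?Dn n \<omega>) \<longlonglongrightarrow> ?D \<omega>" if "\<omega> \<in> space M" for \<omega>
  proof (intro tendsto_sum)
    fix k
    have "block_fluct b (Suc n) k \<omega> = (\<Sum>j<Suc n. wick_exp (b + 2 * r * real k + r * real j / real (Suc n)) \<omega>) / real (Suc n) - 1" for n
      unfolding block_fluct_def grid_point_def sum_subtractf by (simp add: diff_divide_distrib del: sum.lessThan_Suc of_nat_Suc)
    then show "(\<lambda>n. block_fluct b (Suc n) k \<omega>) \<longlonglongrightarrow> mass (b + 2 * r * real k) (b + 2 * r * real k + r) \<omega> / r - 1"
      using mass_Riemann[OF that r] by (simp only:) (intro tendsto_diff tendsto_const)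
  qed
  have "(\<integral>\<^sup>+\<omega>. ennreal (?D \<omega> ^ 4) \<partial>M) = (\<integral>\<^sup>+\<omega>. liminf (\<lambda>n. ennreal (?Dn n \<omega> ^ 4)) \<partial>M)"
    using lim by (intro nn_integral_cong lim_imp_Liminf[symmetric] tendsto_ennrealI tendsto_power) auto
  also have "\<dots> \<le> liminf (\<lambda>n. \<integral>\<^sup>+\<omega>. ennreal (?Dn n \<omega> ^ 4) \<partial>M)"
    by (intro nn_integral_liminf) measurable
  also have "\<dots> \<le> liminf (\<lambda>n. ennreal (48 * (real K)\<^sup>2 * kernel_bound (Suc n)))"
  proof (intro Liminf_mono always_eventually allI)
    fix n
    have "(\<integral>\<^sup>+\<omega>. ennreal (?Dn n \<omega> ^ 4) \<partial>M) = ennreal (\<integral>\<omega>. ?Dn n \<omega> ^ 4 \<partial>M)"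
      by (intro nn_integral_eq_integral block_fourth_moment(1)) auto
    also have "\<dots> \<le> ennreal (48 * (real K)\<^sup>2 * kernel_bound (Suc n))"
      by (intro ennreal_leI block_fourth_moment(2)) auto
    finally show "(\<integral>\<^sup>+\<omega>. ennreal (?Dn n \<omega> ^ 4) \<partial>M) \<le> ennreal (48 * (real K)\<^sup>2 * kernel_bound (Suc n))" .
  qed
  also have "\<dots> = ennreal (48 * (real K)\<^sup>2 * (5 + 0))"
    unfolding kernel_bound_def
    by (intro lim_imp_Liminf tendsto_ennrealI tendsto_intros
        LIMSEQ_Suc[OF lim_const_over_n]) auto
  finally show ?thesis
    by simp
qed

text \<open>Markov's inequality for the fourth power of the fluctuation at the threshold
  \<open>(real K / 2) ^ 4\<close>; hence \<open>16 * 240 = 3840\<close>. The bound contains neither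
  \<open>a\<close> nor \<open>r\<close>.\<close>

lemma mass_small_prob:
  assumes "0 < K"
  shows "prob {\<omega> \<in> space M. mass b (b + 2 * r * real K) \<omega> \<le> r * real K / 2} \<le> 3840 / (real K)\<^sup>2"
proof -
  let ?D = "\<lambda>\<omega>. \<Sum>k<K. mass (b + 2 * r * real k) (b + 2 * r * real k + r) \<omega> / r - 1"
  let ?c = "16 / real K ^ 4"
  have r: "0 < r"
    using ar by simp
  have sub: "{\<omega> \<in> space M. mass b (b + 2 * r * real K) \<omega> \<le> r * real K / 2} \<subseteq>
    {\<omega> \<in> space M. 1 \<le> ennreal ?c * ennreal (?D \<omega> ^ 4)}"
  proof safe
    fix \<omega>
    assume \<omega>: "\<omega> \<in> space M" and small: "mass b (b + 2 * r * real K) \<omega> \<le> r * real K / 2"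
    have "r * (?D \<omega> + real K) = (\<Sum>k<K. mass (b + 2 * r * real k) (b + 2 * r * real k + r) \<omega>)"
      using r by (simp add: sum_subtractf sum_distrib_left)
    also have "\<dots> \<le> r * (real K / 2)"
      using mass_blocks[OF \<omega>] small by (rule order_trans[THEN order_trans]) simp
    finally have "?D \<omega> + real K \<le> real K / 2"
      using r by simp
    then have "real K / 2 \<le> - ?D \<omega>"
      by simp
    then have "(real K / 2) ^ 4 \<le> (- ?D \<omega>) ^ 4"
      by (intro power_mono) auto
    then have "real K ^ 4 / 16 \<le> ?D \<omega> ^ 4"
      by (simp add: power_divide)
    then have "1 \<le> ?c * ?D \<omega> ^ 4"
      using assms by (simp add: field_simps)
    then show "1 \<le> ennreal ?c * ennreal (?D \<omega> ^ 4)"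
      by (subst ennreal_mult[symmetric]) (auto simp flip: ennreal_1 intro: ennreal_leI)
  qed
  have "emeasure M {\<omega> \<in> space M. mass b (b + 2 * r * real K) \<omega> \<le> r * real K / 2} \<le>
    emeasure M {\<omega> \<in> space M. 1 \<le> ennreal ?c * ennreal (?D \<omega> ^ 4)}"
    by (intro emeasure_mono sub) measurable
  also have "\<dots> \<le> ennreal ?c * (\<integral>\<^sup>+\<omega>. ennreal (?D \<omega> ^ 4) * indicator (space M) \<omega> \<partial>M)"
    by (rule nn_integral_Markov_inequality) measurable
  also have "(\<integral>\<^sup>+\<omega>. ennreal (?D \<omega> ^ 4) * indicator (space M) \<omega> \<partial>M) = (\<integral>\<^sup>+\<omega>. ennreal (?D \<omega> ^ 4) \<partial>M)"
    by (intro nn_integral_cong) auto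
  also have "ennreal ?c * \<dots> \<le> ennreal ?c * ennreal (240 * (real K)\<^sup>2)"
    by (intro mult_left_mono fluctuation_fourth_moment) auto
  also have "\<dots> = ennreal (3840 / (real K)\<^sup>2)"
    using assms by (subst ennreal_mult[symmetric]) (auto simp: power4_eq_xxxx power2_eq_square)
  finally show ?thesis
    by (simp add: emeasure_eq_measure)
qed

end

section \<open>Inverses of masses and convergence of moments\<close>

lemma mass_inverse_le: "0 \<le> t \<Longrightarrow> ennreal x \<le> emeasure \<mu> {0..t} \<Longrightarrow> mass_inverse \<mu> x \<le> ereal t"
  unfolding mass_inverse_def by (rule INF_lower) simp

lemma mass_inverse_nonneg: "0 \<le> mass_inverse \<mu> x"
  unfolding mass_inverse_def by (rule INF_greatest) simp

lemma mass_inverse_less_D: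
  "mass_inverse \<mu> x < ereal t \<Longrightarrow> \<exists>s. 0 \<le> s \<and> s < t \<and> ennreal x \<le> emeasure \<mu> {0..s}"
  unfolding mass_inverse_def INF_less_iff by auto

definition half_line_measure :: "real measure \<Rightarrow> bool" where
  "half_line_measure \<mu> \<longleftrightarrow> sets \<mu> = sets (restrict_space borel {0..}) \<and> (\<forall>t\<ge>0. emeasure \<mu> {0..t} < \<infinity>)"

lemma half_line_measure_sets:
  assumes "half_line_measure \<mu>" and "A \<in> sets borel" "A \<subseteq> {0..}"
  shows "A \<in> sets \<mu>"
  using assms by (auto simp: half_line_measure_def sets_restrict_space_iff)

lemma half_line_measure_Icc: "half_line_measure \<mu> \<Longrightarrow> 0 \<le> s \<Longrightarrow> {s..t} \<in> sets \<mu>"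
  by (rule half_line_measure_sets) auto

lemma half_line_measure_space: "half_line_measure \<mu> \<Longrightarrow> space \<mu> = {0..}"
  using sets_eq_imp_space_eq[of \<mu> "restrict_space borel {0..}"]
  by (simp add: half_line_measure_def space_restrict_space)

lemma mass_inverse_ge:
  assumes "half_line_measure \<mu>" "emeasure \<mu> {0..t} < ennreal x"
  shows "ereal t \<le> mass_inverse \<mu> x"
proof (rule ccontr)
  assume "\<not> ereal t \<le> mass_inverse \<mu> x"
  then obtain s where s: "0 \<le> s" "s < t" "ennreal x \<le> emeasure \<mu> {0..s}"
    using mass_inverse_less_D[of \<mu> x t] by (auto simp: not_le)
  have "emeasure \<mu> {0..s} \<le> emeasure \<mu> {0..t}"
    using s by (intro emeasure_mono half_line_measure_Icc assms) auto
  with s(3) have "ennreal x \<le> emeasure \<mu> {0..t}"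
    by (rule order_trans)
  then show False
    using assms(2) by (rule leD[THEN notE])
qed

text \<open>Masses of \<open>{0..s}\<close> grow with \<open>s\<close>, so an admissible point can
  be raised slightly to a rational one. The infimum becomes countable, which gives measurability;
  rejected rationals receive \<infinity> and do not affect it.\<close>

lemma mass_inverse_rational:
  assumes "half_line_measure \<mu>"
  shows "mass_inverse \<mu> x = (INF q\<in>\<rat>. if 0 \<le> q \<and> ennreal x \<le> emeasure \<mu> {0..q} then ereal q else \<infinity>)"
    (is "_ = ?I")
proof (rule antisym)
  show "mass_inverse \<mu> x \<le> ?I"
    by (intro INF_greatest) (auto intro: mass_inverse_le)
  show "?I \<le> mass_inverse \<mu> x"
  proof (rule ccontr)
    assume "\<not> ?I \<le> mass_inverse \<mu> x"
    then obtain q' where "mass_inverse \<mu> x < ereal (real_of_rat q')" "ereal (real_of_rat q') < ?I"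
      using ereal_dense3[of "mass_inverse \<mu> x" ?I] by (auto simp: not_le)
    then obtain q where q: "mass_inverse \<mu> x < ereal q" "ereal q < ?I" "q \<in> \<rat>"
      using that[of "real_of_rat q'"] by simp
    obtain s where s: "0 \<le> s" "s < q" "ennreal x \<le> emeasure \<mu> {0..s}"
      using mass_inverse_less_D[OF q(1)] by blast
    have "emeasure \<mu> {0..s} \<le> emeasure \<mu> {0..q}"
      using s by (intro emeasure_mono half_line_measure_Icc assms) auto
    with s(3) have "ennreal x \<le> emeasure \<mu> {0..q}"
      by (rule order_trans)
    moreover have "0 \<le> q"
      using s by simp
    ultimately have "?I \<le> ereal q"
      using INF_lower[OF q(3), of "\<lambda>q. if 0 \<le> q \<and> ennreal x \<le> emeasure \<mu> {0..q} then ereal q else \<infinity>"] by simp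
    then show False
      using q(2) by (rule leD[THEN notE])
  qed
qed

lemma mass_inverse_measurable:
  assumes "\<And>\<omega>. \<omega> \<in> space M \<Longrightarrow> half_line_measure (\<mu> \<omega>)"
    and meas: "\<And>t. 0 \<le> t \<Longrightarrow> (\<lambda>\<omega>. emeasure (\<mu> \<omega>) {0..t}) \<in> borel_measurable M"
  shows "(\<lambda>\<omega>. mass_inverse (\<mu> \<omega>) x) \<in> borel_measurable M"
proof -
  have "(\<lambda>\<omega>. INF q\<in>\<rat>. if 0 \<le> q \<and> ennreal x \<le> emeasure (\<mu> \<omega>) {0..q} then ereal q else \<infinity>) \<in> borel_measurable M"
  proof (intro borel_measurable_INF countable_rat)
    fix q :: real
    show "(\<lambda>\<omega>. if 0 \<le> q \<and> ennreal x \<le> emeasure (\<mu> \<omega>) {0..q} then ereal q else \<infinity>) \<in> borel_measurable M"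
    proof (cases "0 \<le> q")
      case True
      note [measurable] = meas[OF True]
      show ?thesis
        by measurable
    qed simp
  qed
  then show ?thesis
    using assms(1) by (subst measurable_cong[OF mass_inverse_rational]) auto
qed

section \<open>Vague convergence and continuity of the inverse\<close>

definition tent :: "real \<Rightarrow> real \<Rightarrow> real \<Rightarrow> real" where
  "tent u v t = max 0 (min 1 ((v - t) / (v - u)))"

lemma tent_continuous: "u < v \<Longrightarrow> continuous_on A (tent u v)"
  unfolding tent_def[abs_def] by (intro continuous_intros) auto

lemma tent_bounds:
  assumes "u < v"
  shows "indicator {..u} t \<le> tent u v t" "tent u v t \<le> indicator {..v} t"
  using assms by (auto simp: tent_def indicator_def divide_le_eq le_divide_eq divide_nonpos_pos min_def max_def)

text \<open>An endpoint may carry an atom, so vague convergence does not control the mass of a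
  single interval. Tents do, at the price of moving the endpoint.\<close>

lemma tent_mass:
  assumes \<mu>: "half_line_measure \<mu>" and "0 \<le> u" "u < v"
  shows "measure \<mu> {0..u} \<le> (\<integral>t. tent u v t \<partial>\<mu>)" "(\<integral>t. tent u v t \<partial>\<mu>) \<le> measure \<mu> {0..v}"
proof -
  have fin: "emeasure \<mu> {0..t} < \<infinity>" if "0 \<le> t" for t
    using \<mu> that by (simp add: half_line_measure_def)
  have int: "integrable \<mu> (indicator {0..t} :: real \<Rightarrow> real)" if "0 \<le> t" for t
    using half_line_measure_Icc[OF \<mu>] fin[OF that] by (intro integrable_real_indicator) auto
  have "tent u v \<in> borel_measurable (restrict_space borel {0..})"
    using tent_continuous[OF \<open>u < v\<close>] by (intro borel_measurable_continuous_on_restrict)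
  then have meas: "tent u v \<in> borel_measurable \<mu>"
    using \<mu> by (simp add: half_line_measure_def cong: measurable_cong_sets)
  have bnd: "0 \<le> tent u v t" for t
    by (simp add: tent_def)
  have up: "tent u v t \<le> indicator {0..v} t" if "t \<in> space \<mu>" for t
    using tent_bounds(2)[OF \<open>u < v\<close>, of t] that half_line_measure_space[OF \<mu>] by (auto simp: indicator_def)
  have low: "indicator {0..u} t \<le> tent u v t" if "t \<in> space \<mu>" for t
    using tent_bounds(1)[OF \<open>u < v\<close>, of t] that half_line_measure_space[OF \<mu>] by (auto simp: indicator_def)
  have tent_int: "integrable \<mu> (tent u v)"
    using meas up bnd assms int[of v]
    by (intro Bochner_Integration.integrable_bound[OF int[of v] meas]) auto
  have I: "(\<integral>s. indicator {0..t} s \<partial>\<mu>) = measure \<mu> {0..t}" if "0 \<le> t" for t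
    using half_line_measure_space[OF \<mu>] that by (simp add: Int_absorb1 Int_absorb2 subset_eq)
  show "measure \<mu> {0..u} \<le> (\<integral>t. tent u v t \<partial>\<mu>)"
    unfolding I[OF \<open>0 \<le> u\<close>, symmetric] by (intro integral_mono tent_int int low assms)
  have "0 \<le> v"
    using assms by simp
  then show "(\<integral>t. tent u v t \<partial>\<mu>) \<le> measure \<mu> {0..v}"
    unfolding I[OF \<open>0 \<le> v\<close>, symmetric] by (intro integral_mono tent_int int up)
qed

text \<open>Strict inequalities between a tent integral and \<open>x\<close> pass to the
  approximations. For the lower bound strictness is automatic; for the upper bound it comes from
  \<open>charge\<close>, which excludes that the mass stays flat at level \<open>x\<close>. Atoms
  only make the inverse flat and do no harm.\<close>

lemma mass_inverse_tendsto:
  assumes \<mu>: "half_line_measure \<mu>" and \<mu>n: "\<And>n. half_line_measure (\<mu>n n)"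
    and vague: "\<And>u v. 0 \<le> u \<Longrightarrow> u < v \<Longrightarrow> (\<lambda>n. \<integral>t. tent u v t \<partial>\<mu>n n) \<longlonglongrightarrow> (\<integral>t. tent u v t \<partial>\<mu>)"
    and charge: "\<And>s t. 0 \<le> s \<Longrightarrow> s < t \<Longrightarrow> 0 < emeasure \<mu> {s..t}"
  shows "(\<lambda>n. mass_inverse (\<mu>n n) x) \<longlonglongrightarrow> mass_inverse \<mu> x"
proof (rule order_tendstoI)
  have em: "emeasure \<nu> {0..t} = ennreal (measure \<nu> {0..t})" if "half_line_measure \<nu>" "0 \<le> t" for \<nu> t
    using that by (intro emeasure_eq_ennreal_measure) (auto simp: half_line_measure_def less_top[symmetric])
  {
    fix z
    assume z: "z < mass_inverse \<mu> x"
    show "\<forall>\<^sub>F n in sequentially. z < mass_inverse (\<mu>n n) x"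
    proof (cases "z < 0")
      case True
      then show ?thesis
        by (intro always_eventually allI less_le_trans[OF _ mass_inverse_nonneg])
    next
      case False
      obtain t' where t': "z < ereal t'" "ereal t' < mass_inverse \<mu> x"
        using ereal_dense2[OF z] by auto
      \<comment> \<open>A second level below \<open>t'\<close> makes room for the slope of the
        tent.\<close>
      obtain t where t: "z < ereal t" "t < t'"
        using ereal_dense2[OF t'(1)] by auto
      have "0 \<le> t"
      proof -
        have "0 < ereal t"
          using False t(1) by (meson le_less_trans not_less)
        then show ?thesis
          by simp
      qed
      have "measure \<mu> {0..t'} < x"
      proof (rule ccontr)
        assume "\<not> measure \<mu> {0..t'} < x"
        then have "ennreal x \<le> emeasure \<mu> {0..t'}"
          using em[OF \<mu>, of t'] \<open>0 \<le> t\<close> t by (auto intro: ennreal_leI)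
        then show False
          using mass_inverse_le[of t' x \<mu>] \<open>0 \<le> t\<close> t t' by auto
      qed
      then have "(\<integral>s. tent t t' s \<partial>\<mu>) < x"
        using tent_mass(2)[OF \<mu> \<open>0 \<le> t\<close> t(2)] by simp
      then have "\<forall>\<^sub>F n in sequentially. (\<integral>s. tent t t' s \<partial>\<mu>n n) < x"
        using order_tendstoD(2)[OF vague[OF \<open>0 \<le> t\<close> t(2)]] by simp
      then show ?thesis
      proof eventually_elim
        case (elim n)
        then have "measure (\<mu>n n) {0..t} < x"
          using tent_mass(1)[OF \<mu>n \<open>0 \<le> t\<close> t(2), of n] by simp
        then have "emeasure (\<mu>n n) {0..t} < ennreal x"
          using em[OF \<mu>n \<open>0 \<le> t\<close>] by (simp add: ennreal_lessI[OF le_less_trans[OF measure_nonneg]])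
        then show ?case
          using mass_inverse_ge[OF \<mu>n] t(1) by (auto intro: less_le_trans)
      qed
    qed
  next
    fix z
    assume z: "mass_inverse \<mu> x < z"
    obtain t where t: "mass_inverse \<mu> x < ereal t" "ereal t < z"
      using ereal_dense2[OF z] by auto
    obtain s where s: "0 \<le> s" "s < t" "ennreal x \<le> emeasure \<mu> {0..s}"
      using mass_inverse_less_D[OF t(1)] by auto
    \<comment> \<open>The middle third lies beyond \<open>s\<close> and adds positive mass, which
      makes the inequality strict; the last third is room for the slope of the tent.\<close>
    define d where "d = (t - s) / 3"
    have d: "0 < d" "s + 2 * d < t"
      using s by (auto simp: d_def field_simps)
    have "emeasure \<mu> {0..s} + 0 < emeasure \<mu> {0..s} + emeasure \<mu> {s + d..s + 2 * d}"
      using charge[of "s + d" "s + 2 * d"] d s em[OF \<mu> s(1)]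
      by (subst ennreal_add_left_cancel_less) simp
    also have "\<dots> = emeasure \<mu> ({0..s} \<union> {s + d..s + 2 * d})"
      using d s by (intro plus_emeasure half_line_measure_Icc \<mu>) auto
    also have "\<dots> \<le> emeasure \<mu> {0..s + 2 * d}"
      using d s by (intro emeasure_mono half_line_measure_Icc \<mu>) auto
    finally have "ennreal x < emeasure \<mu> {0..s + 2 * d}"
      using s(3) by (simp add: le_less_trans)
    then have "\<not> ennreal (measure \<mu> {0..s + 2 * d}) \<le> ennreal x"
      using em[OF \<mu>, of "s + 2 * d"] s d by simp
    then have "x < measure \<mu> {0..s + 2 * d}"
      using ennreal_leI not_less by blast
    then have "x < (\<integral>y. tent (s + 2 * d) t y \<partial>\<mu>)"
      using tent_mass(1)[OF \<mu>, of "s + 2 * d" t] d s by simp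
    then have "\<forall>\<^sub>F n in sequentially. x < (\<integral>y. tent (s + 2 * d) t y \<partial>\<mu>n n)"
      using d s by (intro order_tendstoD(1)[OF vague]) auto
    then show "\<forall>\<^sub>F n in sequentially. mass_inverse (\<mu>n n) x < z"
    proof eventually_elim
      case (elim n)
      then have "x \<le> measure (\<mu>n n) {0..t}"
        using tent_mass(2)[OF \<mu>n, of "s + 2 * d" t n] d s by simp
      then have "ennreal x \<le> emeasure (\<mu>n n) {0..t}"
        using em[OF \<mu>n, of t n] s by (simp add: ennreal_leI)
      then have "mass_inverse (\<mu>n n) x \<le> ereal t"
        using s by (intro mass_inverse_le) auto
      then show ?case
        using t(2) by (rule le_less_trans)
    qed
  }
qed

section \<open>From almost sure convergence to convergence of moments\<close>

lemma powr_truncation: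
  fixes z R l p :: real
  assumes "0 \<le> z" "0 < R" "0 < l" "l < p"
  shows "z powr l \<le> (min z R) powr l + R powr (l - p) * z powr p"
proof (cases "z \<le> R")
  case True
  then show ?thesis
    by simp
next
  case False
  then have "z powr l = z powr (l - p) * z powr p"
    using assms by (simp flip: powr_add)
  also have "\<dots> \<le> R powr (l - p) * z powr p"
    using assms False by (intro mult_right_mono powr_mono2') auto
  finally show ?thesis
    using powr_ge_zero[of "min z R" l] by linarith
qed

text \<open>Uniform integrability made explicit: below the level \<open>R\<close> dominated
  convergence applies, and what exceeds it costs at most \<open>R powr (l - p) * C\<close> for every
  \<open>n\<close>, small for large \<open>R\<close> since \<open>l < p\<close>.\<close>

lemma (in prob_space) integral_powr_tendsto_zero:
  fixes Z :: "nat \<Rightarrow> 'a \<Rightarrow> real"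
  assumes [measurable]: "\<And>n. Z n \<in> borel_measurable M" and nonneg: "\<And>n \<omega>. 0 \<le> Z n \<omega>"
    and lim: "AE \<omega> in M. (\<lambda>n. Z n \<omega>) \<longlonglongrightarrow> 0"
    and int: "\<And>n. integrable M (\<lambda>\<omega>. Z n \<omega> powr p)"
    and bound: "\<And>n. (\<integral>\<omega>. Z n \<omega> powr p \<partial>M) \<le> C"
    and lp: "0 < l" "l < p"
  shows "\<And>n. integrable M (\<lambda>\<omega>. Z n \<omega> powr l)" and "(\<lambda>n. \<integral>\<omega>. Z n \<omega> powr l \<partial>M) \<longlonglongrightarrow> 0"
proof -
  have int_min: "integrable M (\<lambda>\<omega>. (min (Z n \<omega>) R) powr l)" if "0 < R" for n R
  proof (rule integrable_const_bound[where B = "R powr l"])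
    show "AE \<omega> in M. norm ((min (Z n \<omega>) R) powr l) \<le> R powr l"
      using lp that nonneg by (intro AE_I2) (auto intro!: powr_mono2)
  qed measurable
  show int_l: "integrable M (\<lambda>\<omega>. Z n \<omega> powr l)" for n
  proof (rule Bochner_Integration.integrable_bound)
    show "integrable M (\<lambda>\<omega>. (min (Z n \<omega>) 1) powr l + Z n \<omega> powr p)"
      by (intro Bochner_Integration.integrable_add int_min int) simp
    have "norm (Z n \<omega> powr l) \<le> norm ((min (Z n \<omega>) 1) powr l + Z n \<omega> powr p)" for \<omega>
    proof -
      have "0 \<le> (min (Z n \<omega>) 1) powr l + Z n \<omega> powr p"
        by simp
      then show ?thesis
        using powr_truncation[OF nonneg, of 1 l p n \<omega>] lp by simp
    qed
    then show "AE \<omega> in M. norm (Z n \<omega> powr l) \<le> norm ((min (Z n \<omega>) 1) powr l + Z n \<omega> powr p)"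
      by simp
  qed measurable
  show "(\<lambda>n. \<integral>\<omega>. Z n \<omega> powr l \<partial>M) \<longlonglongrightarrow> 0"
  proof (rule LIMSEQ_I)
    fix \<epsilon> :: real
    assume "0 < \<epsilon>"
    have "((\<lambda>R. R powr (l - p) * C) \<longlongrightarrow> 0 * C) at_top"
      using lp by (intro tendsto_mult tendsto_neg_powr filterlim_ident tendsto_const) auto
    then have "\<forall>\<^sub>F R in at_top. R powr (l - p) * C < \<epsilon> / 2"
      using \<open>0 < \<epsilon>\<close> by (intro order_tendstoD(2)) auto
    then have "\<forall>\<^sub>F R in at_top. R powr (l - p) * C < \<epsilon> / 2 \<and> 0 < R"
      using eventually_gt_at_top[of 0] by eventually_elim simp
    then obtain R where R: "R powr (l - p) * C < \<epsilon> / 2" "0 < R"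
      by (auto simp: eventually_at_top_linorder)
    have "(\<lambda>n. \<integral>\<omega>. (min (Z n \<omega>) R) powr l \<partial>M) \<longlonglongrightarrow> (\<integral>\<omega>. 0 \<partial>M)"
    proof (rule integral_dominated_convergence[where w = "\<lambda>_. R powr l"])
      show "AE \<omega> in M. (\<lambda>n. (min (Z n \<omega>) R) powr l) \<longlonglongrightarrow> 0"
        using lim
      proof eventually_elim
        case (elim \<omega>)
        have "(\<lambda>n. min (Z n \<omega>) R) \<longlonglongrightarrow> min 0 R"
          by (intro tendsto_min elim tendsto_const)
        then have "(\<lambda>n. min (Z n \<omega>) R) \<longlonglongrightarrow> 0"
          using R by simp
        then show ?case
          using lp nonneg R by (intro tendsto_zero_powrI[where b = l] tendsto_const) auto
      qed
      show "AE \<omega> in M. norm ((min (Z n \<omega>) R) powr l) \<le> R powr l" for n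
        using lp R nonneg by (intro AE_I2) (auto intro!: powr_mono2)
    qed auto
    then have "\<forall>\<^sub>F n in sequentially. (\<integral>\<omega>. (min (Z n \<omega>) R) powr l \<partial>M) < \<epsilon> / 2"
      using \<open>0 < \<epsilon>\<close> by (intro order_tendstoD(2)) auto
    then have "\<forall>\<^sub>F n in sequentially. norm ((\<integral>\<omega>. Z n \<omega> powr l \<partial>M) - 0) < \<epsilon>"
    proof eventually_elim
      case (elim n)
      have "(\<integral>\<omega>. Z n \<omega> powr l \<partial>M) \<le>
          (\<integral>\<omega>. (min (Z n \<omega>) R) powr l + R powr (l - p) * Z n \<omega> powr p \<partial>M)"
        using R int by (intro integral_mono int_l Bochner_Integration.integrable_add int_min
            integrable_mult_right powr_truncation nonneg lp) auto
      also have "\<dots> = (\<integral>\<omega>. (min (Z n \<omega>) R) powr l \<partial>M) + R powr (l - p) * (\<integral>\<omega>. Z n \<omega> powr p \<partial>M)"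
        using R int int_min by simp
      also have "\<dots> \<le> (\<integral>\<omega>. (min (Z n \<omega>) R) powr l \<partial>M) + R powr (l - p) * C"
        using bound by (intro add_left_mono mult_left_mono) auto
      finally have "(\<integral>\<omega>. Z n \<omega> powr l \<partial>M) < \<epsilon>"
        using elim R by simp
      moreover have "0 \<le> (\<integral>\<omega>. Z n \<omega> powr l \<partial>M)"
        by (intro Bochner_Integration.integral_nonneg) simp
      ultimately show ?case
        by simp
    qed
    then show "\<exists>no. \<forall>n\<ge>no. norm ((\<integral>\<omega>. Z n \<omega> powr l \<partial>M) - 0) < \<epsilon>"
      by (simp add: eventually_sequentially)
  qed
qed

text \<open>Summation over dyadic shells gives a geometric series with ratio
  \<open>2 powr p / 4\<close>, below 1 because \<open>p < 2\<close>.\<close>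

lemma (in prob_space) dyadic_tail_moment:
  fixes X :: "'a \<Rightarrow> real"
  assumes [measurable]: "X \<in> borel_measurable M" and nonneg: "\<And>\<omega>. 0 \<le> X \<omega>"
    and tail: "\<And>m. prob {\<omega> \<in> space M. B * 2 ^ m < X \<omega>} \<le> A / 4 ^ m"
    and "0 < B" "0 < p" "p < 2"
  shows "integrable M (\<lambda>\<omega>. X \<omega> powr p)"
    and "(\<integral>\<omega>. X \<omega> powr p \<partial>M) \<le> B powr p + A * (2 * B) powr p / (1 - 2 powr p / 4)"
proof -
  define q :: real where "q = 2 powr p / 4"
  have "2 powr p < (2 :: real) powr 2"
    using \<open>p < 2\<close> by (intro powr_less_mono) auto
  then have q: "0 < q" "q < 1"
    by (auto simp: q_def)
  have "0 \<le> A"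
    using order_trans[OF measure_nonneg tail[of 0]] by simp
  let ?E = "\<lambda>m. {\<omega> \<in> space M. B * 2 ^ m < X \<omega>}"
  let ?b = "\<lambda>m. (B * 2 ^ Suc m) powr p"
  have b: "?b m * (A / 4 ^ m) = A * (2 * B) powr p * q ^ m" for m
  proof -
    have "?b m = (2 * B) powr p * (2 ^ m) powr p"
      using \<open>0 < B\<close> by (simp add: powr_mult[symmetric] mult_ac)
    also have "(2 ^ m) powr p = (2 powr real m) powr p"
      by (simp add: powr_realpow)
    also have "\<dots> = (2 powr p) powr real m"
      by (simp add: powr_powr mult.commute)
    also have "\<dots> = (2 powr p) ^ m"
      by (simp add: powr_realpow)
    finally show ?thesis
      by (simp add: q_def power_divide)
  qed
  have pointwise: "ennreal (X \<omega> powr p) \<le> ennreal (B powr p) + (\<Sum>m. ennreal (?b m) * indicator (?E m) \<omega>)"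
    if "\<omega> \<in> space M" for \<omega>
  proof (cases "X \<omega> \<le> B")
    case True
    then have "ennreal (X \<omega> powr p) \<le> ennreal (B powr p)"
      using nonneg \<open>0 < p\<close> by (intro ennreal_leI powr_mono2) auto
    then show ?thesis
      by (rule order_trans) simp
  next
    case False
    obtain n where n: "X \<omega> / B < 2 ^ n"
      using real_arch_pow[of 2 "X \<omega> / B"] by auto
    \<comment> \<open>The least dyadic level above \<open>X \<omega>\<close>. It is not 0 since
      \<open>X \<omega>\<close> exceeds \<open>B\<close>, and its predecessor \<open>m\<close>
      indexes the shell containing \<open>X \<omega>\<close>.\<close>
    define n0 where "n0 = (LEAST n. X \<omega> \<le> B * 2 ^ n)"
    have le: "X \<omega> \<le> B * 2 ^ n0"
      unfolding n0_def by (rule LeastI[of _ n]) (use n \<open>0 < B\<close> in \<open>simp add: field_simps\<close>)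
    have "n0 \<noteq> 0"
      using False le by (intro notI) simp
    then obtain m where m: "n0 = Suc m"
      by (cases n0) auto
    have "\<not> X \<omega> \<le> B * 2 ^ m"
      by (rule not_less_Least[of m "\<lambda>n. X \<omega> \<le> B * 2 ^ n", folded n0_def]) (simp add: m)
    then have "\<omega> \<in> ?E m"
      using that by auto
    moreover have "X \<omega> powr p \<le> ?b m"
      using nonneg[of \<omega>] le m \<open>0 < p\<close> by (intro powr_mono2) simp_all
    ultimately have "ennreal (X \<omega> powr p) \<le> ennreal (?b m) * indicator (?E m) \<omega>"
      by (simp only: indicator_simps mult_1_right ennreal_leI)
    also have "\<dots> = (\<Sum>m\<in>{m}. ennreal (?b m) * indicator (?E m) \<omega>)"
      by (simp only: sum.insert sum.empty finite.emptyI empty_iff not_False_eq_True add_0_right)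
    also have "\<dots> \<le> (\<Sum>m. ennreal (?b m) * indicator (?E m) \<omega>)"
      by (rule sum_le_suminf) (auto intro: summableI)
    also have "\<dots> \<le> ennreal (B powr p) + \<dots>"
      by simp
    finally show ?thesis .
  qed
  have "(\<integral>\<^sup>+\<omega>. ennreal (X \<omega> powr p) \<partial>M) \<le>
    (\<integral>\<^sup>+\<omega>. ennreal (B powr p) + (\<Sum>m. ennreal (?b m) * indicator (?E m) \<omega>) \<partial>M)"
    by (intro nn_integral_mono pointwise)
  also have "\<dots> = ennreal (B powr p) + (\<Sum>m. ennreal (?b m) * emeasure M (?E m))"
    by (subst nn_integral_add) (auto simp: nn_integral_suminf nn_integral_cmult emeasure_space_1)
  also have "\<dots> \<le> ennreal (B powr p) + (\<Sum>m. ennreal (A * (2 * B) powr p * q ^ m))"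
  proof (intro add_left_mono suminf_le summableI)
    fix m
    have "ennreal (?b m) * emeasure M (?E m) \<le> ennreal (?b m) * ennreal (A / 4 ^ m)"
      unfolding emeasure_eq_measure by (intro mult_left_mono ennreal_leI tail) auto
    then show "ennreal (?b m) * emeasure M (?E m) \<le> ennreal (A * (2 * B) powr p * q ^ m)"
      unfolding b[symmetric] using \<open>0 \<le> A\<close> by (subst ennreal_mult) auto
  qed
  also have "(\<Sum>m. ennreal (A * (2 * B) powr p * q ^ m)) = ennreal (A * (2 * B) powr p * (1 / (1 - q)))"
    using q \<open>0 \<le> A\<close> by (intro suminf_ennreal_eq sums_mult geometric_sums) auto
  finally have nn: "(\<integral>\<^sup>+\<omega>. ennreal (X \<omega> powr p) \<partial>M) \<le> ennreal (B powr p + A * (2 * B) powr p / (1 - q))"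
    using q \<open>0 \<le> A\<close> by (subst ennreal_plus) auto
  show int: "integrable M (\<lambda>\<omega>. X \<omega> powr p)"
    by (rule integrableI_nonneg) (use nn in \<open>auto intro: le_less_trans\<close>)
  have "ennreal (\<integral>\<omega>. X \<omega> powr p \<partial>M) \<le> ennreal (B powr p + A * (2 * B) powr p / (1 - q))"
    using nn int by (subst nn_integral_eq_integral[symmetric]) auto
  then show "(\<integral>\<omega>. X \<omega> powr p \<partial>M) \<le> B powr p + A * (2 * B) powr p / (1 - 2 powr p / 4)"
    using q \<open>0 \<le> A\<close> by (subst (asm) ennreal_le_iff) (auto simp: q_def)
qed

definition tail_moment_bound :: "real \<Rightarrow> real \<Rightarrow> real \<Rightarrow> real" where
  "tail_moment_bound A B p = B powr p + A * (2 * B) powr p / (1 - 2 powr p / 4)"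

lemma (in prob_space) ereal_tail_moment:
  fixes V :: "'a \<Rightarrow> ereal"
  assumes [measurable]: "V \<in> borel_measurable M" and nonneg: "\<And>\<omega>. 0 \<le> V \<omega>"
    and tail: "\<And>m. prob {\<omega> \<in> space M. ereal (B * 2 ^ m) < V \<omega>} \<le> A / 4 ^ m"
    and "0 < B"
  shows "AE \<omega> in M. \<bar>V \<omega>\<bar> \<noteq> \<infinity>"
    and "0 < p \<Longrightarrow> p < 2 \<Longrightarrow> integrable M (\<lambda>\<omega>. \<bar>real_of_ereal (V \<omega>)\<bar> powr p)"
    and "0 < p \<Longrightarrow> p < 2 \<Longrightarrow> (\<integral>\<omega>. \<bar>real_of_ereal (V \<omega>)\<bar> powr p \<partial>M) \<le> tail_moment_bound A B p"
proof -
  \<comment> \<open>The value \<infinity> lies beyond every dyadic level.\<close>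
  have "prob {\<omega> \<in> space M. V \<omega> = \<infinity>} \<le> A / 4 ^ m" for m
    by (rule order_trans[OF _ tail[of m]], rule finite_measure_mono) auto
  moreover have "(\<lambda>m. A / 4 ^ m) \<longlonglongrightarrow> (0 :: real)"
    by (rule LIMSEQ_divide_realpow_zero) simp
  ultimately have "prob {\<omega> \<in> space M. V \<omega> = \<infinity>} \<le> 0"
    by (intro LIMSEQ_le_const) auto
  then have "prob {\<omega> \<in> space M. V \<omega> = \<infinity>} = 0"
    by (simp add: measure_le_0_iff)
  then have "AE \<omega> in M. V \<omega> \<noteq> \<infinity>"
    by (subst (asm) prob_eq_0) auto
  then show "AE \<omega> in M. \<bar>V \<omega>\<bar> \<noteq> \<infinity>"
    using nonneg by (auto elim!: eventually_mono)
  \<comment> \<open>\<open>real_of_ereal\<close> sends \<infinity> to 0, below the threshold, so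
    passing to real values can only shrink the event.\<close>
  have real_tail: "prob {\<omega> \<in> space M. B * 2 ^ m < \<bar>real_of_ereal (V \<omega>)\<bar>} \<le> A / 4 ^ m" for m
  proof (rule order_trans[OF finite_measure_mono tail[of m]])
    show "{\<omega> \<in> space M. B * 2 ^ m < \<bar>real_of_ereal (V \<omega>)\<bar>} \<subseteq> {\<omega> \<in> space M. ereal (B * 2 ^ m) < V \<omega>}"
    proof safe
      fix \<omega>
      assume "B * 2 ^ m < \<bar>real_of_ereal (V \<omega>)\<bar>"
      then show "ereal (B * 2 ^ m) < V \<omega>"
        using nonneg[of \<omega>] by (cases "V \<omega>") auto
    qed
  qed measurable
  have "(\<lambda>\<omega>. \<bar>real_of_ereal (V \<omega>)\<bar>) \<in> borel_measurable M"
    by measurable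
  note moment = dyadic_tail_moment[OF this abs_ge_zero real_tail \<open>0 < B\<close>]
  show "0 < p \<Longrightarrow> p < 2 \<Longrightarrow> integrable M (\<lambda>\<omega>. \<bar>real_of_ereal (V \<omega>)\<bar> powr p)"
    by (rule moment(1))
  show "0 < p \<Longrightarrow> p < 2 \<Longrightarrow> (\<integral>\<omega>. \<bar>real_of_ereal (V \<omega>)\<bar> powr p \<partial>M) \<le> tail_moment_bound A B p"
    unfolding tail_moment_bound_def by (rule moment(2))
qed

text \<open>Fatou's lemma for indicators. It passes tail bounds to a limit variable and bounds the
  event that the limit measure misses an interval.\<close>

lemma (in prob_space) prob_le_of_eventually:
  assumes [measurable]: "S \<in> events" "\<And>n. E n \<in> events"
    and ev: "AE \<omega> in M. \<omega> \<in> S \<longrightarrow> (\<forall>\<^sub>F n in sequentially. \<omega> \<in> E n)"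
    and bound: "\<And>n. prob (E n) \<le> c"
  shows "prob S \<le> c"
proof -
  have "emeasure M S = (\<integral>\<^sup>+\<omega>. indicator S \<omega> \<partial>M)"
    by simp
  also have "\<dots> \<le> (\<integral>\<^sup>+\<omega>. liminf (\<lambda>n. indicator (E n) \<omega>) \<partial>M)"
  proof (rule nn_integral_mono_AE)
    show "AE \<omega> in M. (indicator S \<omega> :: ennreal) \<le> liminf (\<lambda>n. indicator (E n) \<omega>)"
      using ev
    proof eventually_elim
      case (elim \<omega>)
      show ?case
      proof (cases "\<omega> \<in> S")
        case True
        then have "\<forall>\<^sub>F n in sequentially. (1 :: ennreal) \<le> indicator (E n) \<omega>"
          using elim by (auto elim: eventually_mono)
        then have "1 \<le> liminf (\<lambda>n. indicator (E n) \<omega> :: ennreal)"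
          by (rule Liminf_bounded)
        then show ?thesis
          using True by simp
      qed simp
    qed
  qed
  also have "\<dots> \<le> liminf (\<lambda>n. \<integral>\<^sup>+\<omega>. indicator (E n) \<omega> \<partial>M)"
    by (intro nn_integral_liminf) measurable
  also have "\<dots> \<le> liminf (\<lambda>n. ennreal c)"
    using bound by (intro Liminf_mono always_eventually allI) (simp add: emeasure_eq_measure ennreal_leI)
  also have "\<dots> = ennreal c"
    by (simp add: Liminf_const)
  finally show ?thesis
    using order_trans[OF measure_nonneg bound] by (simp add: emeasure_eq_measure)
qed

lemma abs_diff_powr_le:
  fixes x y p :: real
  assumes "0 < p"
  shows "\<bar>x - y\<bar> powr p \<le> 2 powr p * (\<bar>x\<bar> powr p + \<bar>y\<bar> powr p)"
proof -
  have "\<bar>x - y\<bar> powr p \<le> (2 * max \<bar>x\<bar> \<bar>y\<bar>) powr p"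
    using assms by (intro powr_mono2) auto
  also have "\<dots> = 2 powr p * (max \<bar>x\<bar> \<bar>y\<bar>) powr p"
    by (simp add: powr_mult)
  also have "\<dots> \<le> 2 powr p * (\<bar>x\<bar> powr p + \<bar>y\<bar> powr p)"
    by (intro mult_left_mono) (auto simp: max_def)
  finally show ?thesis .
qed

lemma (in prob_space) Lp_convergence_of_tails:
  fixes X :: "nat \<Rightarrow> 'a \<Rightarrow> ereal"
  assumes X [measurable]: "\<And>n. X n \<in> borel_measurable M" and Y [measurable]: "Y \<in> borel_measurable M"
    and X_nonneg: "\<And>n \<omega>. 0 \<le> X n \<omega>" and Y_nonneg: "\<And>\<omega>. 0 \<le> Y \<omega>"
    and lim: "AE \<omega> in M. (\<lambda>n. X n \<omega>) \<longlonglongrightarrow> Y \<omega>"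
    and tail: "\<And>n m. prob {\<omega> \<in> space M. ereal (B * 2 ^ m) < X n \<omega>} \<le> A / 4 ^ m"
    and "0 < B" and l: "1 < l" "l < 2"
  shows "Lp_Cauchy M l X \<and> Lp_tendsto M l X Y"
proof -
  \<comment> \<open>Exceeding a level strictly is an open condition, hence eventually shared by
    \<open>X n \<omega>\<close>; the limit inherits the tails.\<close>
  have tail_Y: "prob {\<omega> \<in> space M. ereal (B * 2 ^ m) < Y \<omega>} \<le> A / 4 ^ m" for m
  proof (rule prob_le_of_eventually[OF _ _ _ tail[of m]])
    show "AE \<omega> in M. \<omega> \<in> {\<omega> \<in> space M. ereal (B * 2 ^ m) < Y \<omega>} \<longrightarrow>
        (\<forall>\<^sub>F n in sequentially. \<omega> \<in> {\<omega> \<in> space M. ereal (B * 2 ^ m) < X n \<omega>})"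
      using lim by eventually_elim (auto dest: order_tendstoD(1))
  qed measurable
  \<comment> \<open>An exponent strictly between \<open>l\<close> and 2: below 2 its moments are
    bounded, above \<open>l\<close> it gives uniform integrability.\<close>
  define p where "p = (l + 2) / 2"
  have p: "0 < p" "l < p" "p < 2" "0 < l"
    using l by (auto simp: p_def)
  note momX = ereal_tail_moment[OF X X_nonneg tail \<open>0 < B\<close>]
  note momY = ereal_tail_moment[OF Y Y_nonneg tail_Y \<open>0 < B\<close>]
  have in_X: "in_Lp M l (X n)" for n
    using momX(1,2) p l by (simp add: in_Lp_def)
  have in_Y: "in_Lp M l Y"
    using momY(1,2) p l by (simp add: in_Lp_def)
  let ?x = "\<lambda>n \<omega>. real_of_ereal (X n \<omega>)" and ?y = "\<lambda>\<omega>. real_of_ereal (Y \<omega>)"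
  define Z where "Z = (\<lambda>n \<omega>. \<bar>?x n \<omega> - ?y \<omega>\<bar>)"
  have Z_meas [measurable]: "Z n \<in> borel_measurable M" for n
    unfolding Z_def by measurable
  let ?C = "2 powr p * (tail_moment_bound A B p + tail_moment_bound A B p)"
  have int_sum: "integrable M (\<lambda>\<omega>. 2 powr p * (\<bar>?x n \<omega>\<bar> powr p + \<bar>?y \<omega>\<bar> powr p))" for n
    using momX(2)[of p] momY(2)[of p] p by simp
  have Z_bound: "Z n \<omega> powr p \<le> 2 powr p * (\<bar>?x n \<omega>\<bar> powr p + \<bar>?y \<omega>\<bar> powr p)" for n \<omega>
    unfolding Z_def by (rule abs_diff_powr_le) (use p in simp)
  have Z_int: "integrable M (\<lambda>\<omega>. Z n \<omega> powr p)" for n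
    using int_sum[of n] by (rule Bochner_Integration.integrable_bound) (use Z_bound in \<open>auto intro!: AE_I2 intro: order_trans[OF _ abs_ge_self]\<close>)
  have Z_mom: "(\<integral>\<omega>. Z n \<omega> powr p \<partial>M) \<le> ?C" for n
  proof -
    have "(\<integral>\<omega>. Z n \<omega> powr p \<partial>M) \<le> (\<integral>\<omega>. 2 powr p * (\<bar>?x n \<omega>\<bar> powr p + \<bar>?y \<omega>\<bar> powr p) \<partial>M)"
      by (intro integral_mono Z_int int_sum Z_bound)
    also have "\<dots> = 2 powr p * ((\<integral>\<omega>. \<bar>?x n \<omega>\<bar> powr p \<partial>M) + (\<integral>\<omega>. \<bar>?y \<omega>\<bar> powr p \<partial>M))"
      using momX(2)[of p] momY(2)[of p] p by simp
    also have "\<dots> \<le> ?C"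
      using momX(3)[of p] momY(3)[of p] p by (intro mult_left_mono add_mono) auto
    finally show ?thesis .
  qed
  have Z_lim: "AE \<omega> in M. (\<lambda>n. Z n \<omega>) \<longlonglongrightarrow> 0"
    using lim momY(1)
  proof eventually_elim
    case (elim \<omega>)
    then have "Y \<omega> = ereal (?y \<omega>)"
      by (simp add: ereal_real)
    then have "(\<lambda>n. ?x n \<omega>) \<longlonglongrightarrow> ?y \<omega>"
      using elim(1) by (intro lim_real_of_ereal) simp
    then show ?case
      unfolding Z_def by (intro tendsto_rabs_zero LIM_zero)
  qed
  have Z_nonneg: "0 \<le> Z n \<omega>" for n \<omega>
    by (simp add: Z_def)
  note Zl = integral_powr_tendsto_zero[OF Z_meas Z_nonneg Z_lim Z_int Z_mom p(4) p(2)]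
  let ?a = "\<lambda>n. \<integral>\<omega>. Z n \<omega> powr l \<partial>M"
  have "(\<lambda>n. (?a n) powr (1 / l)) \<longlonglongrightarrow> 0"
    using Zl(2) l by (intro tendsto_zero_powrI[where b = "1 / l"]) (auto intro!: always_eventually)
  then have "(\<lambda>n. Lp_dist M l (X n) Y) \<longlonglongrightarrow> 0"
    by (simp add: Lp_dist_def Z_def)
  then have "Lp_tendsto M l X Y"
    using in_X in_Y by (simp add: Lp_tendsto_def)
  moreover have "Lp_Cauchy M l X"
    unfolding Lp_Cauchy_def
  proof (intro conjI allI impI in_X)
    fix \<epsilon> :: real
    assume "0 < \<epsilon>"
    \<comment> \<open>Chosen so that two distances to \<open>Y\<close>, with the factor
      \<open>2 powr l\<close> from the quasi-triangle inequality, add up to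
      \<open>\<epsilon> powr l\<close>.\<close>
    define d where "d = \<epsilon> powr l / (2 powr l * 2)"
    have "0 < d"
      using \<open>0 < \<epsilon>\<close> by (simp add: d_def)
    then obtain N where N: "\<And>n. N \<le> n \<Longrightarrow> ?a n < d"
      using order_tendstoD(2)[OF Zl(2)] by (auto simp: eventually_sequentially)
    have "Lp_dist M l (X m) (X n) < \<epsilon>" if "N \<le> m" "N \<le> n" for m n
    proof -
      have "(\<integral>\<omega>. \<bar>?x m \<omega> - ?x n \<omega>\<bar> powr l \<partial>M) \<le> (\<integral>\<omega>. 2 powr l * (Z m \<omega> powr l + Z n \<omega> powr l) \<partial>M)"
      proof (rule integral_mono')
        show "integrable M (\<lambda>\<omega>. 2 powr l * (Z m \<omega> powr l + Z n \<omega> powr l))"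
          using Zl(1) by simp
        show "\<bar>?x m \<omega> - ?x n \<omega>\<bar> powr l \<le> 2 powr l * (Z m \<omega> powr l + Z n \<omega> powr l)" for \<omega>
          using abs_diff_powr_le[OF p(4), of "?x m \<omega> - ?y \<omega>" "?x n \<omega> - ?y \<omega>"] by (simp add: Z_def)
      qed simp
      also have "\<dots> = 2 powr l * (?a m + ?a n)"
        using Zl(1) by simp
      also have "\<dots> < 2 powr l * (d + d)"
        using N[OF that(1)] N[OF that(2)] by (intro mult_strict_left_mono add_strict_mono) auto
      also have "\<dots> = \<epsilon> powr l"
        by (simp add: d_def)
      finally have "(\<integral>\<omega>. \<bar>?x m \<omega> - ?x n \<omega>\<bar> powr l \<partial>M) powr (1 / l) < (\<epsilon> powr l) powr (1 / l)"
        using l by (intro powr_less_mono2) (auto intro!: Bochner_Integration.integral_nonneg)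
      also have "\<dots> = \<epsilon>"
        using l \<open>0 < \<epsilon>\<close> by (simp add: powr_powr)
      finally show ?thesis
        by (simp add: Lp_dist_def)
    qed
    then show "\<exists>N. \<forall>m\<ge>N. \<forall>n\<ge>N. Lp_dist M l (X m) (X n) < \<epsilon>"
      by auto
  qed
  ultimately show ?thesis
    by simp
qed

section \<open>Positivity and convergence of the inverses\<close>

context strip_field
begin

lemma emeasure_density_mass:
  assumes "\<omega> \<in> space M" "0 \<le> b"
  shows "emeasure (density (restrict_space lborel {0..}) (\<lambda>s. ennreal (wick_exp s \<omega>))) {b..c} = ennreal (mass b c \<omega>)"
proof -
  have cont: "continuous_on A (\<lambda>s. wick_exp s \<omega>)" for A
    using assms by (intro wick_exp_continuous)
  then have [measurable]: "(\<lambda>s. wick_exp s \<omega>) \<in> borel_measurable borel"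
    by (rule borel_measurable_continuous_onI)
  have "{b..c} \<in> sets (restrict_space lborel {0..})"
    using assms by (subst sets_restrict_space_iff) auto
  then have "emeasure (density (restrict_space lborel {0..}) (\<lambda>s. ennreal (wick_exp s \<omega>))) {b..c} =
    (\<integral>\<^sup>+s. ennreal (wick_exp s \<omega>) * indicator {b..c} s \<partial>restrict_space lborel {0..})"
    by (intro emeasure_density measurable_restrict_space1) simp_all
  also have "\<dots> = (\<integral>\<^sup>+s. ennreal (wick_exp s \<omega>) * indicator {b..c} s * indicator {0..} s \<partial>lborel)"
    by (subst nn_integral_restrict_space) auto
  also have "\<dots> = (\<integral>\<^sup>+s. ennreal (indicator {b..c} s *\<^sub>R wick_exp s \<omega>) \<partial>lborel)"
    using assms by (intro nn_integral_cong) (auto simp: indicator_def)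
  also have "\<dots> = ennreal (\<integral>s. indicator {b..c} s *\<^sub>R wick_exp s \<omega> \<partial>lborel)"
    using borel_integrable_atLeastAtMost'[OF cont, of b c] wick_exp_pos
    by (intro nn_integral_eq_integral) (auto simp: set_integrable_def less_imp_le)
  also have "(\<integral>s. indicator {b..c} s *\<^sub>R wick_exp s \<omega> \<partial>lborel) = mass b c \<omega>"
    using set_borel_integral_eq_integral(2)[OF borel_integrable_atLeastAtMost'[OF cont, of b c]]
    by (simp add: mass_def set_lebesgue_integral_def)
  finally show ?thesis .
qed

end

text \<open>Almost sure statements combine over countably many intervals; monotonicity extends them
  from rational endpoints to all.\<close>

lemma half_line_measure_charge_extend:
  assumes "half_line_measure \<mu>"
    and rat: "\<And>s t. s \<in> \<rat> \<Longrightarrow> t \<in> \<rat> \<Longrightarrow> 0 \<le> s \<Longrightarrow> s < t \<Longrightarrow> emeasure \<mu> {s..t} \<noteq> 0"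
    and "0 \<le> s" "s < t"
  shows "0 < emeasure \<mu> {s..t}"
proof -
  obtain u where u: "s < u" "u < t" "u \<in> \<rat>"
    using Rats_dense_in_real[OF \<open>s < t\<close>] by auto
  obtain v where v: "u < v" "v < t" "v \<in> \<rat>"
    using Rats_dense_in_real[OF \<open>u < t\<close>] by auto
  have "emeasure \<mu> {u..v} \<noteq> 0"
    using rat[of u v] u v assms(3) by simp
  then have "0 < emeasure \<mu> {u..v}"
    by (simp add: zero_less_iff_neq_zero)
  also have "\<dots> \<le> emeasure \<mu> {s..t}"
    using u v assms by (intro emeasure_mono half_line_measure_Icc) auto
  finally show ?thesis .
qed

section \<open>The cone field as a strip field\<close>

locale cone_chaos = hyperbolic_noise M W for M :: "'a measure" and W +
  fixes U :: "real \<Rightarrow> real \<Rightarrow> 'a \<Rightarrow> real" and \<eta> :: "'a \<Rightarrow> real measure" and \<gamma> :: real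
  assumes field: "cone_field M W U" and limit: "chaos_limit M \<gamma> U \<eta>"
    and \<gamma>: "0 < \<gamma>" "12 * \<gamma>\<^sup>2 \<le> 1"
begin

lemma U_measurable: "0 < \<epsilon> \<Longrightarrow> \<epsilon> < 1 \<Longrightarrow> U \<epsilon> s \<in> borel_measurable M"
  using field by (simp add: cone_field_def)

lemma U_eq: "0 < \<epsilon> \<Longrightarrow> \<epsilon> < 1 \<Longrightarrow> AE \<omega> in M. U \<epsilon> s \<omega> = W (strip \<epsilon> 1 s) \<omega>"
  using field by (simp add: cone_field_def truncated_cone_eq_strip)

lemma U_continuous:
  assumes "\<omega> \<in> space M" "0 < \<epsilon>" "\<epsilon> < 1"
  shows "continuous_on UNIV (\<lambda>s. U \<epsilon> s \<omega>)"
proof -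
  have "continuous_on ({0<..<1} \<times> UNIV) (\<lambda>(\<epsilon>, s). U \<epsilon> s \<omega>)"
    using field assms by (simp add: cone_field_def)
  then have "continuous_on UNIV ((\<lambda>(\<epsilon>, s). U \<epsilon> s \<omega>) \<circ> (\<lambda>s. (\<epsilon>, s)))"
    using assms by (intro continuous_on_compose continuous_intros) (auto elim: continuous_on_subset)
  then show ?thesis
    by (simp add: o_def)
qed

lemma strip_field_U:
  assumes "0 < \<epsilon>" "\<epsilon> < 1"
  shows "strip_field M W (U \<epsilon>) \<gamma> \<epsilon> 1"
  by unfold_locales (use assms \<gamma> in \<open>auto intro: U_measurable U_eq U_continuous\<close>)

text \<open>Subtracting the coarse field removes all noise above height \<open>r\<close>, so the
  correlation range shrinks from 1 to \<open>r\<close>.\<close>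

lemma strip_field_U_diff:
  assumes "0 < \<epsilon>" "\<epsilon> < r" "r < 1"
  shows "strip_field M W (\<lambda>s \<omega>. U \<epsilon> s \<omega> - U r s \<omega>) \<gamma> \<epsilon> r"
proof
  fix s
  have "AE \<omega> in M. W (strip \<epsilon> 1 s - strip r 1 s) \<omega> = W (strip \<epsilon> 1 s) \<omega> - W (strip r 1 s) \<omega>"
    using assms by (intro W_Diff strip_noise_sets strip_mono) auto
  moreover have "AE \<omega> in M. U \<epsilon> s \<omega> = W (strip \<epsilon> 1 s) \<omega>" "AE \<omega> in M. U r s \<omega> = W (strip r 1 s) \<omega>"
    using assms by (auto intro!: U_eq)
  ultimately show "AE \<omega> in M. U \<epsilon> s \<omega> - U r s \<omega> = W (strip \<epsilon> r s) \<omega>"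
    by eventually_elim (use assms in \<open>simp add: strip_Diff\<close>)
qed (use assms \<gamma> in \<open>auto intro!: continuous_on_diff borel_measurable_diff U_measurable U_continuous\<close>)

abbreviation cone_mass :: "real \<Rightarrow> real \<Rightarrow> real \<Rightarrow> 'a \<Rightarrow> real" where
  "cone_mass \<epsilon> \<equiv> strip_field.mass (U \<epsilon>) \<gamma> \<epsilon> 1"

lemma U_variance:
  assumes "0 < \<epsilon>" "\<epsilon> < 1"
  shows "(\<integral>\<omega>. (U \<epsilon> s \<omega>)\<^sup>2 \<partial>M) = ln (1 / \<epsilon>)"
proof -
  note strip = strip_noise_sets[OF assms(1) less_imp_le[OF assms(2)], of s]
  note [measurable] = U_measurable[OF assms] W_measurable[OF strip]
  have "(\<integral>\<omega>. (U \<epsilon> s \<omega>)\<^sup>2 \<partial>M) = (\<integral>\<omega>. W (strip \<epsilon> 1 s) \<omega> * W (strip \<epsilon> 1 s) \<omega> \<partial>M)"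
    by (rule integral_cong_AE) (use U_eq[OF assms, of s] in \<open>auto simp: power2_eq_square\<close>)
  also have "\<dots> = ln (1 / \<epsilon>)"
    using strip assms by (simp only: covariance) (use strip_cov_self[of \<epsilon> 1 s] in \<open>simp add: strip_cov_def\<close>)
  finally show ?thesis .
qed

lemma chaos_approx_eq:
  assumes "0 < \<epsilon>" "\<epsilon> < 1"
  shows "chaos_approx M \<gamma> U \<epsilon> \<omega> =
    density (restrict_space lborel {0..}) (\<lambda>s. ennreal (strip_field.wick_exp (U \<epsilon>) \<gamma> \<epsilon> 1 s \<omega>))"
  by (simp add: chaos_approx_def U_variance[OF assms] strip_field.wick_exp_def[OF strip_field_U[OF assms]])

lemma emeasure_chaos_approx:
  assumes "0 < \<epsilon>" "\<epsilon> < 1" "\<omega> \<in> space M" "0 \<le> b"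
  shows "emeasure (chaos_approx M \<gamma> U \<epsilon> \<omega>) {b..c} = ennreal (cone_mass \<epsilon> b c \<omega>)"
  unfolding chaos_approx_eq[OF assms(1,2)]
  by (rule strip_field.emeasure_density_mass[OF strip_field_U[OF assms(1,2)] assms(3,4)])

lemma half_line_measure_chaos_approx:
  assumes "0 < \<epsilon>" "\<epsilon> < 1" "\<omega> \<in> space M"
  shows "half_line_measure (chaos_approx M \<gamma> U \<epsilon> \<omega>)"
proof -
  have "sets (chaos_approx M \<gamma> U \<epsilon> \<omega>) = sets (restrict_space borel {0..})"
    by (simp add: chaos_approx_def cong: sets_restrict_space_cong)
  then show ?thesis
    using assms by (simp add: half_line_measure_def emeasure_chaos_approx)
qed

lemma half_line_measure_\<eta>: "\<omega> \<in> space M \<Longrightarrow> half_line_measure (\<eta> \<omega>)"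
  using limit by (simp add: chaos_limit_def random_measure_nonneg_def half_line_measure_def)

lemma emeasure_\<eta>_measurable [measurable]:
  assumes "0 \<le> s"
  shows "(\<lambda>\<omega>. emeasure (\<eta> \<omega>) {s..t}) \<in> borel_measurable M"
proof -
  have "{s..t} \<in> sets (restrict_space borel {0..})"
    using assms by (subst sets_restrict_space_iff) auto
  then show ?thesis
    using limit by (simp add: chaos_limit_def random_measure_nonneg_def)
qed

lemma vague_limit:
  "AE \<omega> in M. \<forall>f :: real \<Rightarrow> real. continuous_on {0..} f \<and> (\<exists>R. \<forall>t>R. f t = 0) \<longrightarrow>
    ((\<lambda>\<epsilon>. \<integral>t. f t \<partial>(chaos_approx M \<gamma> U \<epsilon> \<omega>)) \<longlongrightarrow> (\<integral>t. f t \<partial>(\<eta> \<omega>))) (at_right 0)"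
  using limit by (simp add: chaos_limit_def)

lemma mass_inverse_chaos_approx_measurable:
  assumes "0 < \<epsilon>" "\<epsilon> < 1"
  shows "(\<lambda>\<omega>. mass_inverse (chaos_approx M \<gamma> U \<epsilon> \<omega>) x) \<in> borel_measurable M"
proof (rule mass_inverse_measurable[OF half_line_measure_chaos_approx[OF assms]])
  fix t :: real
  assume "0 \<le> t"
  note [measurable] = strip_field.mass_measurable[OF strip_field_U[OF assms]]
  have "(\<lambda>\<omega>. ennreal (cone_mass \<epsilon> 0 t \<omega>)) \<in> borel_measurable M"
    by measurable
  then show "(\<lambda>\<omega>. emeasure (chaos_approx M \<gamma> U \<epsilon> \<omega>) {0..t}) \<in> borel_measurable M"
    by (subst measurable_cong[OF emeasure_chaos_approx[OF assms]]) auto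
qed

text \<open>At range 1 the \<open>K\<close> blocks and their gaps fill
  \<open>{0..2 * real K}\<close> and the blocks have mean mass \<open>K\<close>. As \<open>x\<close>
  is at most half of it, not reaching \<open>x\<close> by then means too little mass.\<close>

lemma mass_inverse_tail:
  assumes "0 < \<epsilon>" "\<epsilon> < 1" "0 < K" "2 * x \<le> real K"
  shows "prob {\<omega> \<in> space M. ereal (2 * real K) < mass_inverse (chaos_approx M \<gamma> U \<epsilon> \<omega>) x} \<le> 3840 / (real K)\<^sup>2"
proof -
  interpret S: strip_field M W "U \<epsilon>" \<gamma> \<epsilon> 1
    by (rule strip_field_U[OF assms(1,2)])
  have "{\<omega> \<in> space M. ereal (2 * real K) < mass_inverse (chaos_approx M \<gamma> U \<epsilon> \<omega>) x} \<subseteq>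
    {\<omega> \<in> space M. S.mass 0 (0 + 2 * 1 * real K) \<omega> \<le> 1 * real K / 2}"
  proof safe
    fix \<omega>
    assume \<omega>: "\<omega> \<in> space M" and large: "ereal (2 * real K) < mass_inverse (chaos_approx M \<gamma> U \<epsilon> \<omega>) x"
    show "S.mass 0 (0 + 2 * 1 * real K) \<omega> \<le> 1 * real K / 2"
    proof (rule ccontr)
      assume "\<not> S.mass 0 (0 + 2 * 1 * real K) \<omega> \<le> 1 * real K / 2"
      then have "x \<le> S.mass 0 (2 * real K) \<omega>"
        using assms(4) by simp
      then have "ennreal x \<le> emeasure (chaos_approx M \<gamma> U \<epsilon> \<omega>) {0..2 * real K}"
        using assms \<omega> by (simp add: emeasure_chaos_approx ennreal_leI)
      then have "mass_inverse (chaos_approx M \<gamma> U \<epsilon> \<omega>) x \<le> ereal (2 * real K)"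
        by (intro mass_inverse_le) auto
      then show False
        using large by simp
    qed
  qed
  then have "prob {\<omega> \<in> space M. ereal (2 * real K) < mass_inverse (chaos_approx M \<gamma> U \<epsilon> \<omega>) x} \<le>
      prob {\<omega> \<in> space M. S.mass 0 (0 + 2 * 1 * real K) \<omega> \<le> 1 * real K / 2}"
    by (intro finite_measure_mono) measurable
  also have "\<dots> \<le> 3840 / (real K)\<^sup>2"
    by (rule S.mass_small_prob[OF \<open>0 < K\<close>])
  finally show ?thesis .
qed

section \<open>Positivity of the limit measure on intervals\<close>

lemma bump_integral_lower:
  assumes \<mu>: "half_line_measure \<mu>" and "0 \<le> s" "s < t" "0 \<le> d" "s + d \<le> t - d"
  shows "d * measure \<mu> {s + d..t - d} \<le> (\<integral>y. max 0 (min (y - s) (t - y)) \<partial>\<mu>)"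
proof -
  let ?\<phi> = "\<lambda>y::real. max 0 (min (y - s) (t - y))"
  have fin: "emeasure \<mu> {u..v} < \<infinity>" if "0 \<le> u" for u v
  proof (cases "0 \<le> v")
    case True
    have "emeasure \<mu> {u..v} \<le> emeasure \<mu> {0..v}"
      using that by (intro emeasure_mono half_line_measure_Icc \<mu>) auto
    then show ?thesis
      using \<mu> True by (auto simp: half_line_measure_def intro: le_less_trans)
  next
    case False
    then have "{u..v} = {}"
      using that by auto
    then show ?thesis
      by simp
  qed
  have int: "integrable \<mu> (indicator {u..v} :: real \<Rightarrow> real)" if "0 \<le> u" for u v
    using half_line_measure_Icc[OF \<mu> that] fin[OF that] by (intro integrable_real_indicator) auto
  have "?\<phi> \<in> borel_measurable (restrict_space borel {0..})"
    by (intro borel_measurable_continuous_on_restrict continuous_intros)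
  then have meas: "?\<phi> \<in> borel_measurable \<mu>"
    using \<mu> by (simp add: half_line_measure_def cong: measurable_cong_sets)
  have "norm (?\<phi> y) \<le> norm ((t - s) * indicator {s..t} y)" for y
    using assms by (auto simp: indicator_def)
  then have \<phi>_int: "integrable \<mu> ?\<phi>"
    using int[OF \<open>0 \<le> s\<close>, of t] by (intro Bochner_Integration.integrable_bound[OF _ meas, where f = "\<lambda>y. (t - s) * indicator {s..t} y"]) auto
  have sets: "{s + d..t - d} \<in> sets \<mu>"
    using assms by (intro half_line_measure_Icc) auto
  then have "d * measure \<mu> {s + d..t - d} = (\<integral>y. d * indicator {s + d..t - d} y \<partial>\<mu>)"
    using sets.sets_into_space[OF sets] by (simp add: Int_absorb2)
  also have "\<dots> \<le> (\<integral>y. ?\<phi> y \<partial>\<mu>)"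
    by (intro integral_mono \<phi>_int integrable_mult_right int) (use assms in \<open>auto simp: indicator_def\<close>)
  finally show ?thesis .
qed

text \<open>The density at level \<epsilon> is the coarse density at level \<open>r\<close> times
  that of the difference field. The coarse factor is continuous and positive, so its minimum on the
  interval can serve as \<open>\<kappa>\<close>, which depends on \<open>\<omega>\<close> but not on
  \<epsilon>.\<close>

lemma cone_mass_lower:
  assumes "\<omega> \<in> space M" "0 < r" "r < 1"
  obtains \<kappa> where "0 < \<kappa>"
    and "\<And>\<epsilon>. 0 < \<epsilon> \<Longrightarrow> \<epsilon> < r \<Longrightarrow>
      \<kappa> * strip_field.mass (\<lambda>s \<omega>. U \<epsilon> s \<omega> - U r s \<omega>) \<gamma> \<epsilon> r b c \<omega> \<le> cone_mass \<epsilon> b c \<omega>"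
proof -
  interpret R: strip_field M W "U r" \<gamma> r 1
    by (rule strip_field_U[OF assms(2,3)])
  obtain \<kappa> where \<kappa>: "0 < \<kappa>" "\<And>s. s \<in> {b..c} \<Longrightarrow> \<kappa> \<le> R.wick_exp s \<omega>"
  proof (cases "b \<le> c")
    case True
    then have "\<exists>s\<in>{b..c}. \<forall>y\<in>{b..c}. R.wick_exp s \<omega> \<le> R.wick_exp y \<omega>"
      using assms by (intro continuous_attains_inf R.wick_exp_continuous) auto
    then show ?thesis
      using that R.wick_exp_pos by blast
  next
    case False
    then show ?thesis
      using that[of 1] by simp
  qed
  have "\<kappa> * strip_field.mass (\<lambda>s \<omega>. U \<epsilon> s \<omega> - U r s \<omega>) \<gamma> \<epsilon> r b c \<omega> \<le> cone_mass \<epsilon> b c \<omega>"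
    if \<epsilon>: "0 < \<epsilon>" "\<epsilon> < r" for \<epsilon>
  proof -
    have "\<epsilon> < 1"
      using \<epsilon> assms by simp
    interpret S: strip_field M W "U \<epsilon>" \<gamma> \<epsilon> 1
      by (rule strip_field_U[OF \<epsilon>(1) \<open>\<epsilon> < 1\<close>])
    interpret V: strip_field M W "\<lambda>s \<omega>. U \<epsilon> s \<omega> - U r s \<omega>" \<gamma> \<epsilon> r
      by (rule strip_field_U_diff[OF \<epsilon> assms(3)])
    \<comment> \<open>The variances of the two layers add up, so the normalisations multiply
      correctly.\<close>
    have "ln (1 / \<epsilon>) = ln (1 / r) + ln (r / \<epsilon>)"
      using \<epsilon> by (simp add: ln_div)
    then have prod: "S.wick_exp s \<omega> = R.wick_exp s \<omega> * V.wick_exp s \<omega>" for s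
      unfolding S.wick_exp_def R.wick_exp_def V.wick_exp_def exp_add[symmetric] by (simp add: algebra_simps)
    have "\<kappa> * V.mass b c \<omega> = integral {b..c} (\<lambda>s. \<kappa> * V.wick_exp s \<omega>)"
      by (simp add: V.mass_def)
    also have "\<dots> \<le> integral {b..c} (\<lambda>s. S.wick_exp s \<omega>)"
      using assms(1) \<kappa>(2) V.wick_exp_pos
      by (intro Henstock_Kurzweil_Integration.integral_le integrable_continuous_real
          continuous_on_mult continuous_on_const V.wick_exp_continuous S.wick_exp_continuous)
        (auto simp: prod intro!: mult_right_mono less_imp_le)
    finally show ?thesis
      by (simp add: S.mass_def)
  qed
  then show ?thesis
    using that \<kappa>(1) by blast
qed

text \<open>If the limit misses \<open>{s..t}\<close>, the bump integrals of the approximations tend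
  to 0. Since \<open>\<kappa>\<close> does not move, the fine masses of the middle part eventually
  fall below half the mean of its \<open>m\<close> blocks, an event of small probability.\<close>

lemma \<eta>_null_prob:
  assumes "0 \<le> s" "s < t" "0 < m" "(t - s) / (4 * real m) < 1"
  shows "prob {\<omega> \<in> space M. emeasure (\<eta> \<omega>) {s..t} = 0} \<le> 3840 / (real m)\<^sup>2"
proof -
  \<comment> \<open>The middle half from \<open>s + d\<close> to \<open>t - d\<close> has length
    \<open>2 * d = 2 * r * m\<close>: exactly \<open>m\<close> blocks with their gaps.\<close>
  define d where "d = (t - s) / 4"
  define r where "r = (t - s) / (4 * real m)"
  have "0 < d" "0 < r" "r < 1"
    using assms by (auto simp: d_def r_def)
  have span: "s + d + 2 * r * real m = t - d" "s + d \<le> t - d"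
    using assms by (auto simp: d_def r_def field_simps)
  \<comment> \<open>The double successor keeps \<open>\<epsilon> n\<close> strictly below
    \<open>r\<close> already for \<open>n = 0\<close>.\<close>
  define \<epsilon> where "\<epsilon> = (\<lambda>n. r / real (Suc (Suc n)))"
  have \<epsilon>: "0 < \<epsilon> n" "\<epsilon> n < r" "\<epsilon> n < 1" for n
  proof -
    show "0 < \<epsilon> n"
      using \<open>0 < r\<close> by (simp add: \<epsilon>_def)
    have "r * 1 < r * real (Suc (Suc n))"
      using \<open>0 < r\<close> by (intro mult_strict_left_mono) auto
    then show "\<epsilon> n < r"
      by (simp add: \<epsilon>_def divide_less_eq)
    then show "\<epsilon> n < 1"
      using \<open>r < 1\<close> by simp
  qed
  have "\<epsilon> \<longlonglongrightarrow> 0"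
    unfolding \<epsilon>_def by (intro LIMSEQ_Suc lim_const_over_n)
  then have \<epsilon>_lim: "filterlim \<epsilon> (at_right 0) sequentially"
    using \<epsilon>(1) by (intro tendsto_imp_filterlim_at_right) auto
  let ?V = "\<lambda>n. strip_field.mass (\<lambda>s \<omega>. U (\<epsilon> n) s \<omega> - U r s \<omega>) \<gamma> (\<epsilon> n) r (s + d) (t - d)"
  note V = strip_field_U_diff[OF \<epsilon>(1) \<epsilon>(2) \<open>r < 1\<close>]
  note [measurable] = strip_field.mass_measurable[OF V]
  have ev: "AE \<omega> in M. \<omega> \<in> {\<omega> \<in> space M. emeasure (\<eta> \<omega>) {s..t} = 0} \<longrightarrow>
      (\<forall>\<^sub>F n in sequentially. \<omega> \<in> {\<omega> \<in> space M. ?V n \<omega> \<le> r * real m / 2})"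
    using vague_limit
  proof eventually_elim
    case (elim \<omega>)
    show ?case
    proof safe
      assume \<omega>: "\<omega> \<in> space M" and null: "emeasure (\<eta> \<omega>) {s..t} = 0"
      let ?\<phi> = "\<lambda>y::real. max 0 (min (y - s) (t - y))"
      have "continuous_on {0..} ?\<phi> \<and> (\<exists>R. \<forall>y>R. ?\<phi> y = 0)"
        by (intro conjI continuous_intros exI[of _ t]) auto
      then have "((\<lambda>\<epsilon>. \<integral>y. ?\<phi> y \<partial>(chaos_approx M \<gamma> U \<epsilon> \<omega>)) \<longlongrightarrow> (\<integral>y. ?\<phi> y \<partial>(\<eta> \<omega>))) (at_right 0)"
        using elim by blast
      then have lim: "(\<lambda>n. \<integral>y. ?\<phi> y \<partial>(chaos_approx M \<gamma> U (\<epsilon> n) \<omega>)) \<longlonglongrightarrow> (\<integral>y. ?\<phi> y \<partial>(\<eta> \<omega>))"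
        by (rule filterlim_compose[OF _ \<epsilon>_lim])
      have "{s..t} \<in> null_sets (\<eta> \<omega>)"
        using null assms by (auto intro!: half_line_measure_Icc half_line_measure_\<eta> \<omega>)
      then have "AE y in \<eta> \<omega>. ?\<phi> y = 0"
        by (rule AE_I') auto
      then have "(\<integral>y. ?\<phi> y \<partial>(\<eta> \<omega>)) = 0"
        by (rule integral_eq_zero_AE)
      obtain \<kappa> where \<kappa>: "0 < \<kappa>"
        and low: "\<And>\<epsilon>. 0 < \<epsilon> \<Longrightarrow> \<epsilon> < r \<Longrightarrow>
          \<kappa> * strip_field.mass (\<lambda>s \<omega>. U \<epsilon> s \<omega> - U r s \<omega>) \<gamma> \<epsilon> r (s + d) (t - d) \<omega> \<le> cone_mass \<epsilon> (s + d) (t - d) \<omega>"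
        using cone_mass_lower[OF \<omega> \<open>0 < r\<close> \<open>r < 1\<close>, of "s + d" "t - d"] by blast
      \<comment> \<open>The bump is at least \<open>d\<close> on the middle half and the coarse
        factor at least \<open>\<kappa>\<close>, so this threshold forces the fine mass below
        \<open>r * real m / 2\<close>.\<close>
      have "\<forall>\<^sub>F n in sequentially. (\<integral>y. ?\<phi> y \<partial>(chaos_approx M \<gamma> U (\<epsilon> n) \<omega>)) < d * \<kappa> * (r * real m / 2)"
        using lim \<open>0 < d\<close> \<open>0 < r\<close> \<kappa> assms unfolding \<open>(\<integral>y. ?\<phi> y \<partial>(\<eta> \<omega>)) = 0\<close>
        by (intro order_tendstoD(2)) auto
      then show "\<forall>\<^sub>F n in sequentially. \<omega> \<in> {\<omega> \<in> space M. ?V n \<omega> \<le> r * real m / 2}"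
      proof eventually_elim
        case (elim n)
        have "measure (chaos_approx M \<gamma> U (\<epsilon> n) \<omega>) {s + d..t - d} = cone_mass (\<epsilon> n) (s + d) (t - d) \<omega>"
          using emeasure_chaos_approx[OF \<epsilon>(1) \<epsilon>(3) \<omega>, of "s + d" n "t - d"] assms(1) \<open>0 < d\<close>
            strip_field.mass_nonneg[OF strip_field_U[OF \<epsilon>(1) \<epsilon>(3)] \<omega>]
          by (simp add: measure_def)
        then have "d * cone_mass (\<epsilon> n) (s + d) (t - d) \<omega> \<le> (\<integral>y. ?\<phi> y \<partial>(chaos_approx M \<gamma> U (\<epsilon> n) \<omega>))"
          using bump_integral_lower[OF half_line_measure_chaos_approx[OF \<epsilon>(1) \<epsilon>(3) \<omega>] assms(1,2) less_imp_le[OF \<open>0 < d\<close>] span(2), of n]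
          by simp
        moreover have "d * (\<kappa> * ?V n \<omega>) \<le> d * cone_mass (\<epsilon> n) (s + d) (t - d) \<omega>"
          using low[OF \<epsilon>(1) \<epsilon>(2)] \<open>0 < d\<close> by (intro mult_left_mono) auto
        ultimately have "(d * \<kappa>) * ?V n \<omega> < (d * \<kappa>) * (r * real m / 2)"
          using elim by (simp only: mult.assoc)
        then show ?case
          using \<omega> \<open>0 < d\<close> \<kappa> by (auto simp: mult_less_cancel_left_pos intro: less_imp_le)
      qed
    qed
  qed
  have bound: "prob {\<omega> \<in> space M. ?V n \<omega> \<le> r * real m / 2} \<le> 3840 / (real m)\<^sup>2" for n
    using strip_field.mass_small_prob[OF V assms(3), of n "s + d"] by (simp only: span)
  show ?thesis
    by (rule prob_le_of_eventually[OF _ _ ev bound]) (use assms(1) in measurable)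
qed

text \<open>The number \<open>m\<close> of blocks is free, so the probability lies below
  \<open>3840 / (real m)\<^sup>2\<close> for all large \<open>m\<close>; largeness also brings the
  range below 1.\<close>

lemma \<eta>_charges:
  assumes "0 \<le> s" "s < t"
  shows "AE \<omega> in M. emeasure (\<eta> \<omega>) {s..t} \<noteq> 0"
proof -
  have "(\<lambda>m. 3840 / (real m)\<^sup>2) \<longlonglongrightarrow> 0"
    by (intro tendsto_divide_0[OF tendsto_const] filterlim_at_top_imp_at_infinity
        filterlim_pow_at_top filterlim_real_sequentially) auto
  moreover have "\<forall>\<^sub>F m in sequentially. prob {\<omega> \<in> space M. emeasure (\<eta> \<omega>) {s..t} = 0} \<le> 3840 / (real m)\<^sup>2"
  proof -
    obtain m0 :: nat where m0: "(t - s) / 4 < real m0"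
      using reals_Archimedean2 by blast
    have "prob {\<omega> \<in> space M. emeasure (\<eta> \<omega>) {s..t} = 0} \<le> 3840 / (real m)\<^sup>2" if "m0 \<le> m" for m
    proof (rule \<eta>_null_prob[OF assms])
      have "(t - s) / 4 < real m"
        using m0 that by linarith
      moreover have "0 < real m"
        using assms(2) by (intro less_trans[OF _ \<open>(t - s) / 4 < real m\<close>]) simp
      ultimately show "0 < m" "(t - s) / (4 * real m) < 1"
        by (auto simp: divide_less_eq)
    qed
    then show ?thesis
      by (auto simp: eventually_sequentially)
  qed
  ultimately have "prob {\<omega> \<in> space M. emeasure (\<eta> \<omega>) {s..t} = 0} \<le> 0"
    by (intro tendsto_lowerbound[where f = "\<lambda>m. 3840 / (real m)\<^sup>2"]) auto
  then have "prob {\<omega> \<in> space M. emeasure (\<eta> \<omega>) {s..t} = 0} = 0"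
    by (simp add: measure_le_0_iff)
  moreover have "{\<omega> \<in> space M. emeasure (\<eta> \<omega>) {s..t} = 0} \<in> events"
    using assms(1) by measurable
  ultimately show ?thesis
    by (subst (asm) prob_eq_0) (auto elim: eventually_mono)
qed

lemma \<eta>_charges_all: "AE \<omega> in M. \<forall>s t. 0 \<le> s \<longrightarrow> s < t \<longrightarrow> 0 < emeasure (\<eta> \<omega>) {s..t}"
proof -
  have "AE \<omega> in M. \<forall>s\<in>\<rat>. \<forall>t\<in>\<rat>. 0 \<le> s \<longrightarrow> s < t \<longrightarrow> emeasure (\<eta> \<omega>) {s..t} \<noteq> 0"
    by (simp only: AE_ball_countable[OF countable_rat]) (auto intro: \<eta>_charges)
  then show ?thesis
    using AE_space by eventually_elim (auto intro!: half_line_measure_charge_extend half_line_measure_\<eta>)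
qed

section \<open>Convergence of the inverses\<close>

lemma mass_inverse_converges:
  assumes "\<And>n. 0 < \<epsilon> n" "\<And>n. \<epsilon> n < 1" "\<epsilon> \<longlonglongrightarrow> 0"
  shows "AE \<omega> in M. (\<lambda>n. mass_inverse (chaos_approx M \<gamma> U (\<epsilon> n) \<omega>) x) \<longlonglongrightarrow> mass_inverse (\<eta> \<omega>) x"
  using vague_limit \<eta>_charges_all AE_space
proof eventually_elim
  case (elim \<omega>)
  have lim: "filterlim \<epsilon> (at_right 0) sequentially"
    using assms by (intro tendsto_imp_filterlim_at_right) auto
  show ?case
  proof (rule mass_inverse_tendsto[OF half_line_measure_\<eta> half_line_measure_chaos_approx])
    fix u v :: real
    assume "0 \<le> u" "u < v"
    have "tent u v t = 0" if "v < t" for t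
    proof (rule antisym)
      show "tent u v t \<le> 0"
        using tent_bounds(2)[OF \<open>u < v\<close>, of t] that by simp
      show "0 \<le> tent u v t"
        by (simp add: tent_def)
    qed
    then have "continuous_on {0..} (tent u v) \<and> (\<exists>R. \<forall>t>R. tent u v t = 0)"
      using tent_continuous[OF \<open>u < v\<close>] by blast
    then have "((\<lambda>\<epsilon>. \<integral>t. tent u v t \<partial>(chaos_approx M \<gamma> U \<epsilon> \<omega>)) \<longlongrightarrow> (\<integral>t. tent u v t \<partial>(\<eta> \<omega>))) (at_right 0)"
      using elim(1) by blast
    then show "(\<lambda>n. \<integral>t. tent u v t \<partial>(chaos_approx M \<gamma> U (\<epsilon> n) \<omega>)) \<longlonglongrightarrow> (\<integral>t. tent u v t \<partial>(\<eta> \<omega>))"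
      by (rule filterlim_compose[OF _ lim])
  qed (use elim assms in auto)
qed

lemma mass_inverse_Lp_convergence:
  assumes \<epsilon>: "\<And>n. 0 < \<epsilon> n" "\<And>n. \<epsilon> n < 1" "\<epsilon> \<longlonglongrightarrow> 0" and "1 < l" "l < 2"
  shows "Lp_Cauchy M l (\<lambda>n \<omega>. mass_inverse (chaos_approx M \<gamma> U (\<epsilon> n) \<omega>) x) \<and>
    Lp_tendsto M l (\<lambda>n \<omega>. mass_inverse (chaos_approx M \<gamma> U (\<epsilon> n) \<omega>) x) (\<lambda>\<omega>. mass_inverse (\<eta> \<omega>) x)"
proof -
  \<comment> \<open>The absolute value makes \<open>K\<close> positive for every sign of
    \<open>x\<close>. Using \<open>K * 2 ^ m\<close> blocks yields the dyadic levels, and the square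
    in the tail bound yields \<open>4 ^ m\<close>.\<close>
  obtain K :: nat where K: "2 * \<bar>x\<bar> + 1 < real K"
    using reals_Archimedean2 by blast
  then have "0 < K"
    by (cases K) auto
  show ?thesis
  proof (rule Lp_convergence_of_tails[where B = "2 * real K" and A = "3840 / (real K)\<^sup>2"])
    show "(\<lambda>\<omega>. mass_inverse (\<eta> \<omega>) x) \<in> borel_measurable M"
      by (rule mass_inverse_measurable) (auto intro: half_line_measure_\<eta> emeasure_\<eta>_measurable)
    fix n m
    have "2 * x \<le> real K * 1"
      using K by linarith
    also have "\<dots> \<le> real K * 2 ^ m"
      by (intro mult_left_mono) auto
    finally have "prob {\<omega> \<in> space M. ereal (2 * real (K * 2 ^ m)) <
        mass_inverse (chaos_approx M \<gamma> U (\<epsilon> n) \<omega>) x} \<le> 3840 / (real (K * 2 ^ m))\<^sup>2"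
      using \<epsilon> \<open>0 < K\<close> by (intro mass_inverse_tail) auto
    also have "3840 / (real (K * 2 ^ m))\<^sup>2 = 3840 / (real K)\<^sup>2 / 4 ^ m"
      by (simp add: power_mult_distrib power2_eq_square flip: power_mult_distrib)
    finally show "prob {\<omega> \<in> space M. ereal (2 * real K * 2 ^ m) <
        mass_inverse (chaos_approx M \<gamma> U (\<epsilon> n) \<omega>) x} \<le> 3840 / (real K)\<^sup>2 / 4 ^ m"
      by (simp add: mult.assoc)
  qed (use assms \<open>0 < K\<close> in \<open>auto intro: mass_inverse_chaos_approx_measurable mass_inverse_nonneg mass_inverse_converges\<close>)
qed

end

theorem theorem3:
  fixes M :: "'a measure"
    and W :: "(real \<times> real) set \<Rightarrow> 'a \<Rightarrow> real"
    and U :: "real \<Rightarrow> real \<Rightarrow> 'a \<Rightarrow> real"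
    and \<eta> :: "'a \<Rightarrow> real measure"
    and \<gamma> \<delta> \<epsilon> B x l :: real
  assumes "hyperbolic_white_noise M W"
    and "cone_field M W U"
    and "chaos_limit M \<gamma> U \<eta>"
    and "0 < \<gamma>" and "\<gamma> < 1 / (12 * sqrt 2)"
    and "0 < \<delta>"
    and "0 < \<epsilon>" and "\<epsilon> < B" and "x \<in> {\<epsilon>..B}"
    and "l \<in> {1<..<2}"
  shows "Lp_Cauchy M l (\<lambda>n. inverse_approx M \<gamma> U \<delta> x (Suc n)) \<and>
         Lp_tendsto M l (\<lambda>n. inverse_approx M \<gamma> U \<delta> x (Suc n)) (\<lambda>\<omega>. mass_inverse (\<eta> \<omega>) x)"
proof -
  \<comment> \<open>The right-hand side is 1/288, so \<open>12 * \<gamma>\<^sup>2\<close> is at most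
    1/24.\<close>
  have "\<gamma>\<^sup>2 \<le> (1 / (12 * sqrt 2))\<^sup>2"
    using assms by (intro power_mono) auto
  then have "12 * \<gamma>\<^sup>2 \<le> 1"
    by (simp add: power_divide power_mult_distrib)
  then interpret cone_chaos M W U \<eta> \<gamma>
    using assms by unfold_locales auto
  let ?\<epsilon> = "\<lambda>n. 2 powr (- \<delta> * real (Suc n)) :: real"
  have pow: "?\<epsilon> n = (2 powr (- \<delta>)) ^ Suc n" for n
    by (subst powr_powr[symmetric], subst powr_realpow) auto
  have base: "2 powr (- \<delta>) < (1 :: real)"
    using assms powr_less_mono[of "- \<delta>" 0 2] by simp
  have "?\<epsilon> \<longlonglongrightarrow> 0"
    unfolding pow using base by (intro LIMSEQ_Suc LIMSEQ_power_zero) simp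
  moreover have "?\<epsilon> n < 1" for n
    unfolding pow using base by (intro power_Suc_less_one) auto
  ultimately show ?thesis
    unfolding inverse_approx_def[abs_def]
    using assms by (intro mass_inverse_Lp_convergence) auto
qed

end
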